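(* Let $\tau>0$. Let $u:\mathbb R\times(0,\tau)\to\mathbb R$ be twice continuously differentiable in $x$ and continuously differentiable in $t$, with $\partial_tu-\partial_x^2u=0$ on $\mathbb R\times(0,\tau)$. Suppose that for each $0<\sigma<\tau$: $u(\cdot,t)\in\mathcal A_{c,\sigma}$ and the quantity $\|u(\cdot,t)\|_\sigma\sqrt{\tau-\sigma-t}$ is bounded for all $0<t<\tau-\sigma$, and $\lim_{t\to0^+}\|u(\cdot,t)-f\|_\sigma=0$, for some $f\in\mathcal A_{c,\tau}$. Then $u(x,t)=f\ast\Theta_t(x)$ for all $(x,t)\in\mathbb R\times(0,\tau)$; i.e., $f\ast\Theta_t$ is the unique solution with these properties.
   Context: Let $\mathcal B_c$ be the set of continuous $G:\mathbb R\to\mathbb R$ with real limits at $\pm\infty$ and $\lim_{x\to-\infty}G(x)=0$, and $\mathcal A_c$ the distributions $G'$ ($G\in\mathcal B_c$) with integral $\int_a^bG'=G(b)-G(a)$ and Alexiewicz norm $\|G'\|=\sup_{x<y}|G(y)-G(x)|$; for $h$ of bounded variation, $\int_{-\infty}^\infty G'h:=G(\infty)h(\infty)-\int G\,dh$ (Henstock–Stieltjes). For $\sigma>0$ let $\omega_\sigma(x)=e^{-x^2/(4\sigma)}$. The weighted space $\mathcal A_{c,\sigma}$ is the set of distributions $f$ on $\mathbb R$ such that $f\omega_\sigma\in\mathcal A_c$, normed by $\|f\|_\sigma=\|f\omega_\sigma\|$ (in the paper this space is defined through primitives solving a Volterra equation, and this characterization is proved equivalent); $\mathcal A_{c,\tau}\subset\mathcal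 A_{c,\sigma}$ for $\sigma<\tau$. For $f\in\mathcal A_{c,\tau}$ and $0<t<\tau$, $f\ast\Theta_t(x)=\int_{-\infty}^\infty(f\omega_\tau)(\xi)\,\frac{\Theta_t(x-\xi)}{\omega_\tau(\xi)}\,d\xi$ (an $\mathcal A_c$ integral against a bounded-variation function), where $\Theta_t(x)=(4\pi t)^{-1/2}e^{-x^2/(4t)}$. *)

theory Defs
  imports "HOL-Analysis.Analysis"
begin

text \<open>Distributions on the real line are modelled as functionals on test functions
  (only their values on test functions matter).\<close>
type_synonym distr = "(real \<Rightarrow> real) \<Rightarrow> real"

definition test_fun :: "(real \<Rightarrow> real) \<Rightarrow> bool" where
  "test_fun \<phi> \<longleftrightarrow> (\<forall>n x. ((deriv ^^ n) \<phi>) differentiable (at x))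
      \<and> (\<exists>R. \<forall>x. R < \<bar>x\<bar> \<longrightarrow> \<phi> x = 0)"

definition fun_dist :: "(real \<Rightarrow> real) \<Rightarrow> distr" where
  "fun_dist g = (\<lambda>\<phi>. integral UNIV (\<lambda>x. g x * \<phi> x))"

definition Bc :: "(real \<Rightarrow> real) set" where
  "Bc = {G. continuous_on UNIV G \<and> (G \<longlongrightarrow> 0) at_bot \<and> (\<exists>L. (G \<longlongrightarrow> L) at_top)}"

text \<open>Alexiewicz norm of G' in terms of its primitive G.\<close>
definition alex_norm :: "(real \<Rightarrow> real) \<Rightarrow> real" where
  "alex_norm G = (SUP p \<in> {p::real\<times>real. fst p < snd p}. \<bar>G (snd p) - G (fst p)\<bar>)"

definition omega :: "real \<Rightarrow> real \<Rightarrow> real" where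
  "omega \<sigma> x = exp (- x\<^sup>2 / (4 * \<sigma>))"

definition Theta :: "real \<Rightarrow> real \<Rightarrow> real" where
  "Theta t x = exp (- x\<^sup>2 / (4 * t)) / sqrt (4 * pi * t)"

text \<open>G \<in> B_c is the primitive of the distribution f*omega_sigma, i.e. f*omega_sigma = G'
  in the sense of distributions: (f omega)(phi) = f(omega phi) = - int G phi'.\<close>
definition acprim :: "real \<Rightarrow> distr \<Rightarrow> (real \<Rightarrow> real) \<Rightarrow> bool" where
  "acprim \<sigma> f G \<longleftrightarrow> G \<in> Bc \<and>
     (\<forall>\<phi>. test_fun \<phi> \<longrightarrow>
        f (\<lambda>x. omega \<sigma> x * \<phi> x) = - integral UNIV (\<lambda>x. G x * deriv \<phi> x))"

definition Acw :: "real \<Rightarrow> distr \<Rightarrow> bool" where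
  "Acw \<sigma> f \<longleftrightarrow> (\<exists>G. acprim \<sigma> f G)"

text \<open>Weighted norm ||f||_sigma = ||f omega_sigma|| (primitive is unique).\<close>
definition wnorm :: "real \<Rightarrow> distr \<Rightarrow> real" where
  "wnorm \<sigma> f = alex_norm (THE G. acprim \<sigma> f G)"

text \<open>A_c integral of G' against h (h of bounded variation, here C^1):
  G(inf) h(inf) - int G dh, the Stieltjes integral with C^1 integrator written as int G h'.\<close>
definition ac_int :: "(real \<Rightarrow> real) \<Rightarrow> (real \<Rightarrow> real) \<Rightarrow> real" where
  "ac_int G h = Lim at_top (\<lambda>x. G x * h x) - integral UNIV (\<lambda>x. G x * deriv h x)"

definition heat_conv :: "real \<Rightarrow> distr \<Rightarrow> real \<Rightarrow> real \<Rightarrow> real" where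
  "heat_conv \<tau> f t x =
     ac_int (THE G. acprim \<tau> f G) (\<lambda>\<xi>. Theta t (x - \<xi>) / omega \<tau> \<xi>)"

end

theory Submission
  imports Defs "HOL-Probability.Distributions" "HOL-Real_Asymp.Real_Asymp"
begin

text \<open>Fix \<open>x\<close> and \<open>0 < T < \<tau>\<close>, and test \<open>u(\<cdot>, t)\<close> against the backward heat kernel
  \<open>\<Theta>\<close> at time \<open>T - t\<close> centred at \<open>x\<close>, localized by a cutoff \<open>\<chi>\<close> of width \<open>R\<close>. As \<open>t \<rightarrow> T\<close> this
  pairing tends to \<open>u(x, T)\<close>. As \<open>t \<rightarrow> 0\<close> it tends to the localized pairing of \<open>f\<close> with the kernel,
  by convergence in the norm for one weight \<open>\<sigma>\<close> between \<open>T\<close> and \<open>\<tau>\<close>; this tends to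
  the convolution as \<open>R \<rightarrow> \<infinity>\<close>. By the heat equation, the time derivative of the pairing is
  the integral of \<open>u\<close> times \<open>2 \<Theta>' \<chi>' + \<Theta> \<chi>''\<close>. Integrating by parts, it is controlled by the bounded
  primitive of \<open>u(\<cdot>, t) \<omega>\<^sub>\<sigma>\<close>, where \<open>T - t < \<sigma> < \<tau> - t\<close>: the first inequality makes
  \<open>\<Theta> / \<omega>\<^sub>\<sigma>\<close> decay like a Gaussian, the second makes the norm of \<open>u(\<cdot>, t)\<close> available.
  The resulting bound is \<open>O(1 / R)\<close> uniformly in \<open>t\<close>.\<close>

section \<open>Smooth functions\<close>

text \<open>The norm bounds only the primitive of \<open>u \<omega>\<^sub>\<sigma>\<close>, never
  \<open>u\<close> itself, so one more derivative has to be moved onto the localized kernel.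
  Derivatives of \<Theta> bring in factors \<open>1 / s\<close> with \<open>s = T - t\<close>, and
  the bound must survive \<open>s\<close> tending to 0. Hence an explicit polynomial cutoff, flat at
  its centre: it supplies the powers of \<open>z\<close> that turn every \<open>1 / s\<close> into
  \<open>z\<^sup>2 / s\<close>, which the Gaussian absorbs.

  No single weight serves all times: for every \<open>t\<close> in (0, T) it would have to be at
  least \<open>T\<close> and at most \<open>\<tau> - T\<close>, which is impossible if
  \<open>T > \<tau> / 2\<close>. The pairing itself mentions no weight, so the weight may change
  with \<open>t\<close>.

  Norm and convolution are defined through \<open>THE\<close> primitive; that they denote anything
  rests on the uniqueness of primitives, for which smooth test functions have to be constructed.
  Moreover \<open>f\<close> comes with a primitive for \<tau> while convergence is stated for
  \<open>\<sigma> < \<tau>\<close>, so primitives are converted between weights.\<close>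

lemma DERIV_imp_continuous_on:
  "(\<And>x. (f has_real_derivative f' x) (at x)) \<Longrightarrow> continuous_on S f"
  by (meson DERIV_isCont continuous_at_imp_continuous_on)

lemma antiderivative_real:
  fixes g :: "real \<Rightarrow> real"
  assumes "continuous_on UNIV g"
  obtains F where "\<And>x. (F has_real_derivative g x) (at x)"
proof -
  have "\<exists>F. \<forall>x::real. ereal x > -\<infinity> \<longrightarrow> ereal x < \<infinity> \<longrightarrow> (F has_vector_derivative g x) (at x)"
    by (rule einterval_antiderivative) (use assms continuous_on_eq_continuous_at in auto)
  then show ?thesis
    using that by (auto simp: has_real_derivative_iff_has_vector_derivative)
qed

definition smooth :: "(real \<Rightarrow> real) \<Rightarrow> bool" where
  "smooth f \<longleftrightarrow> (\<forall>n x. ((deriv ^^ n) f) differentiable (at x))"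

text \<open>Derivatives are unique, so \<open>deriv\<close> maps \<open>C\<close> into itself and
  all iterated derivatives of \<open>f\<close> stay in \<open>C\<close>. Smoothness is thus proved
  by exhibiting a class closed under differentiation, without formulas for n-th derivatives.\<close>

lemma smooth_coinduct:
  assumes "f \<in> C"
    and "\<And>g. g \<in> C \<Longrightarrow> \<exists>g'\<in>C. \<forall>x. (g has_real_derivative g' x) (at x)"
  shows "smooth f"
proof -
  have step: "deriv g \<in> C" if "g \<in> C" for g
  proof -
    obtain g' where g': "g' \<in> C" "\<forall>x. (g has_real_derivative g' x) (at x)"
      using assms(2) \<open>g \<in> C\<close> by blast
    then have "deriv g = g'"
      by (auto intro: DERIV_imp_deriv)
    with g' show ?thesis by simp
  qed
  have "(deriv ^^ n) f \<in> C" for n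
    by (induction n) (auto intro: step assms(1))
  then show ?thesis
    unfolding smooth_def using assms(2) real_differentiable_def by metis
qed

lemma smooth_DERIV: "smooth f \<Longrightarrow> (f has_real_derivative deriv f x) (at x)"
  unfolding smooth_def
  by (metis DERIV_deriv_iff_real_differentiable funpow_0)

lemma smooth_deriv: "smooth f \<Longrightarrow> smooth (deriv f)"
  unfolding smooth_def by (metis comp_apply funpow_Suc_right)

lemma smooth_continuous_on: "smooth f \<Longrightarrow> continuous_on S f"
  by (meson DERIV_isCont continuous_at_imp_continuous_on smooth_DERIV)

lemma smooth_antideriv:
  assumes "smooth g" and "\<And>x. (f has_real_derivative g x) (at x)"
  shows "smooth f"
proof (rule smooth_coinduct[where C = "insert f {h. smooth h}"])
  fix h assume "h \<in> insert f {h. smooth h}"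
  then show "\<exists>g'\<in>insert f {h. smooth h}. \<forall>x. (h has_real_derivative g' x) (at x)"
    using assms smooth_DERIV smooth_deriv by fastforce
qed simp

text \<open>Sums are included because the class has to be closed under differentiation.\<close>
inductive_set product_sums :: "(real \<Rightarrow> real) set" where
  product: "smooth f \<Longrightarrow> smooth g \<Longrightarrow> (\<lambda>x. f x * g x) \<in> product_sums"
| sum: "f \<in> product_sums \<Longrightarrow> g \<in> product_sums \<Longrightarrow> (\<lambda>x. f x + g x) \<in> product_sums"

lemma smooth_product_sums:
  assumes "f \<in> product_sums"
  shows "smooth f"
  using assms
proof (rule smooth_coinduct)
  fix h assume "h \<in> product_sums"
  then show "\<exists>h'\<in>product_sums. \<forall>x. (h has_real_derivative h' x) (at x)"
  proof induction
    case (product f g)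
    have "(\<lambda>x. deriv f x * g x + deriv g x * f x) \<in> product_sums"
      using product by (intro product_sums.intros smooth_deriv)
    moreover have "((\<lambda>x. f x * g x) has_real_derivative deriv f x * g x + deriv g x * f x) (at x)" for x
      using product by (intro DERIV_mult smooth_DERIV)
    ultimately show ?case
      by (intro bexI[of _ "\<lambda>x. deriv f x * g x + deriv g x * f x"]) auto
  next
    case (sum f g)
    then obtain f' g' where "f' \<in> product_sums" "\<forall>x. (f has_real_derivative f' x) (at x)"
      "g' \<in> product_sums" "\<forall>x. (g has_real_derivative g' x) (at x)"
      by blast
    then show ?case
      by (intro bexI[of _ "\<lambda>x. f' x + g' x"]) (auto intro: DERIV_add product_sums.sum)
  qed
qed

lemma smooth_const: "smooth (\<lambda>x. c)"
proof (rule smooth_coinduct[where C = "range (\<lambda>c x. c)"])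
  fix g :: "real \<Rightarrow> real" assume "g \<in> range (\<lambda>c x. c)"
  then show "\<exists>g'\<in>range (\<lambda>c x. c). \<forall>x. (g has_real_derivative g' x) (at x)"
    by (intro bexI[of _ "\<lambda>x. 0"]) auto
qed simp

lemma smooth_mult: "smooth f \<Longrightarrow> smooth g \<Longrightarrow> smooth (\<lambda>x. f x * g x)"
  by (rule smooth_product_sums[OF product_sums.product])

lemma smooth_add:
  assumes "smooth f" "smooth g"
  shows "smooth (\<lambda>x. f x + g x)"
proof -
  have "(\<lambda>x. f x * 1 + g x * 1) \<in> product_sums"
    by (rule product_sums.sum[OF product_sums.product[OF assms(1) smooth_const]
          product_sums.product[OF assms(2) smooth_const]])
  then show ?thesis
    using smooth_product_sums by simp
qed

lemma smooth_diff:
  assumes "smooth f" "smooth g"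
  shows "smooth (\<lambda>x. f x - g x)"
proof -
  have "smooth (\<lambda>x. f x + (-1) * g x)"
    by (intro smooth_add smooth_mult smooth_const assms)
  then show ?thesis by simp
qed

lemma smooth_affine:
  assumes "smooth f"
  shows "smooth (\<lambda>x. f (a * x + b))"
\<comment> \<open>The scalar \<open>k\<close> collects the factors \<open>a\<close> that the chain
  rule produces.\<close>
proof (rule smooth_coinduct[where C = "{h. \<exists>k g. smooth g \<and> h = (\<lambda>x. k * g (a * x + b))}"])
  show "(\<lambda>x. f (a * x + b)) \<in> {h. \<exists>k g. smooth g \<and> h = (\<lambda>x. k * g (a * x + b))}"
    using assms by (auto intro!: exI[of _ 1])
  fix h assume "h \<in> {h. \<exists>k g. smooth g \<and> h = (\<lambda>x. k * g (a * x + b))}"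
  then obtain k g where h: "smooth g" "h = (\<lambda>x. k * g (a * x + b))"
    by blast
  have "(h has_real_derivative (k * a) * deriv g (a * x + b)) (at x)" for x
    unfolding h(2)
    by (rule derivative_eq_intros DERIV_chain2[OF smooth_DERIV[OF h(1)]] refl | simp)+
  then show "\<exists>h'\<in>{h. \<exists>k g. smooth g \<and> h = (\<lambda>x. k * g (a * x + b))}. \<forall>x. (h has_real_derivative h' x) (at x)"
    using smooth_deriv[OF h(1)] by (intro bexI[of _ "\<lambda>x. (k * a) * deriv g (a * x + b)"]) blast+
qed

lemma smooth_gaussian: "smooth (\<lambda>x. exp (c * x\<^sup>2))"
proof (rule smooth_coinduct[where C = "range (\<lambda>p x. poly p x * exp (c * x\<^sup>2))"])
  show "(\<lambda>x. exp (c * x\<^sup>2)) \<in> range (\<lambda>p x. poly p x * exp (c * x\<^sup>2))"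
    by (rule image_eqI[where x = 1]) simp_all
  fix g assume "g \<in> range (\<lambda>p x. poly p x * exp (c * x\<^sup>2))"
  then obtain p where g: "g = (\<lambda>x. poly p x * exp (c * x\<^sup>2))"
    by blast
  have "(g has_real_derivative poly (pderiv p + smult (2 * c) (pCons 0 p)) x * exp (c * x\<^sup>2)) (at x)" for x
    unfolding g by (rule derivative_eq_intros poly_DERIV refl | simp add: algebra_simps)+
  then show "\<exists>g'\<in>range (\<lambda>p x. poly p x * exp (c * x\<^sup>2)). \<forall>x. (g has_real_derivative g' x) (at x)"
    by (intro bexI[OF _ rangeI]) blast
qed

section \<open>Compactly supported smooth bumps\<close>

lemma tendsto_poly_div_exp: "((\<lambda>y. y ^ k * poly p y / exp y) \<longlongrightarrow> (0::real)) at_top"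
proof (induction p arbitrary: k)
  case 0
  then show ?case by simp
next
  \<comment> \<open>\<open>pCons a p\<close> evaluates to \<open>a + y * poly p y\<close>; the extra
    \<open>y\<close> goes into the power, which is why \<open>k\<close> is generalized.\<close>
  case (pCons a p)
  have "((\<lambda>y. a * (y ^ k / exp y) + y ^ Suc k * poly p y / exp y) \<longlongrightarrow> a * 0 + 0) at_top"
    by (intro tendsto_intros tendsto_power_div_exp_0 pCons)
  then show ?case
    by (simp add: field_simps)
qed

text \<open>For \<open>p = 1\<close> this is the classical smooth function that is flat at 0. The
  polynomial in \<open>1 / x\<close> makes the family closed under differentiation: since
  \<open>1 / x\<close> has derivative \<open>- (1 / x)\<^sup>2\<close>, the new polynomial is
  \<open>X\<^sup>2 (p - p')\<close>.\<close>

definition flat :: "real poly \<Rightarrow> real \<Rightarrow> real" where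
  "flat p x = (if 0 < x then poly p (inverse x) * exp (- inverse x) else 0)"

lemma DERIV_flat: "(flat p has_real_derivative flat (monom 1 2 * (p - pderiv p)) x) (at x)"
proof -
  consider "x < 0" | "x = 0" | "0 < x" by linarith
  then show ?thesis
  proof cases
    case 1
    have "(flat p has_real_derivative 0) (at x) \<longleftrightarrow> ((\<lambda>x. 0) has_real_derivative 0) (at x)"
    proof (rule DERIV_cong_ev)
      show "\<forall>\<^sub>F y in nhds x. flat p y = 0"
        using 1 eventually_nhds_in_open[of "{..<0}" x]
        by (auto elim!: eventually_mono simp: flat_def)
    qed (use 1 in auto)
    with 1 show ?thesis
      by (simp add: flat_def)
  next
    case 3
    have "(flat p has_real_derivative flat (monom 1 2 * (p - pderiv p)) x) (at x) \<longleftrightarrow>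
        ((\<lambda>x. poly p (inverse x) * exp (- inverse x)) has_real_derivative flat (monom 1 2 * (p - pderiv p)) x) (at x)"
    proof (rule DERIV_cong_ev)
      show "\<forall>\<^sub>F y in nhds x. flat p y = poly p (inverse y) * exp (- inverse y)"
        using 3 eventually_nhds_in_open[of "{0<..}" x]
        by (auto elim!: eventually_mono simp: flat_def)
    qed (use 3 in auto)
    moreover have "((\<lambda>x. poly p (inverse x) * exp (- inverse x)) has_real_derivative flat (monom 1 2 * (p - pderiv p)) x) (at x)"
      using 3 by (auto intro!: derivative_eq_intros DERIV_chain2[OF poly_DERIV]
          simp: flat_def poly_monom field_simps power2_eq_square)
    ultimately show ?thesis by simp
  next
    case 2
    have right: "((\<lambda>y. flat p y / y) \<longlongrightarrow> 0) (at_right 0)"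
    proof -
      have "((\<lambda>y. inverse y ^ 1 * poly p (inverse y) / exp (inverse y)) \<longlongrightarrow> (0::real)) (at_right 0)"
        by (rule filterlim_compose[OF tendsto_poly_div_exp filterlim_inverse_at_top_right])
      then show ?thesis
        by (rule Lim_transform_eventually)
          (auto simp: flat_def eventually_at_filter field_simps exp_minus)
    qed
    have left: "((\<lambda>y. flat p y / y) \<longlongrightarrow> 0) (at_left 0)"
      by (rule Lim_transform_eventually[OF tendsto_const])
        (auto simp: flat_def eventually_at_filter)
    have "((\<lambda>y. flat p y / y) \<longlongrightarrow> 0) (at 0)"
      using left right by (simp add: filterlim_split_at)
    then show ?thesis
      unfolding has_field_derivative_iff 2 by (simp add: flat_def)
  qed
qed

lemma smooth_flat: "smooth (flat p)"
proof (rule smooth_coinduct[where C = "range flat"])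
  fix g assume "g \<in> range flat"
  then show "\<exists>g'\<in>range flat. \<forall>x. (g has_real_derivative g' x) (at x)"
    using DERIV_flat by blast
qed simp

lemma bump_exists:
  obtains \<eta> :: "real \<Rightarrow> real"
  where "smooth \<eta>" "\<And>x. \<bar>x\<bar> < e \<Longrightarrow> 0 < \<eta> x" "\<And>x. e \<le> \<bar>x\<bar> \<Longrightarrow> \<eta> x = 0"
proof
  \<comment> \<open>Positive exactly where \<open>e + x\<close> and \<open>e - x\<close> both are.
    The factors 1 and -1 match the shape expected by \<open>smooth_affine\<close>.\<close>
  let ?\<eta> = "\<lambda>x. flat 1 (1 * x + e) * flat 1 (-1 * x + e)"
  show "smooth ?\<eta>"
    by (intro smooth_mult smooth_affine smooth_flat)
  show "0 < ?\<eta> x" if "\<bar>x\<bar> < e" for x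
    using that by (auto simp: flat_def)
  show "?\<eta> x = 0" if "e \<le> \<bar>x\<bar>" for x
    using that by (auto simp: flat_def)
qed

lemma test_fun_iff: "test_fun \<phi> \<longleftrightarrow> smooth \<phi> \<and> (\<exists>R. \<forall>x. R < \<bar>x\<bar> \<longrightarrow> \<phi> x = 0)"
  by (simp add: test_fun_def smooth_def)

lemma continuous_compact_support_integral:
  fixes g :: "real \<Rightarrow> real"
  assumes "continuous_on UNIV g" "\<And>x. R < \<bar>x\<bar> \<Longrightarrow> g x = 0"
  shows "(g has_integral integral {-R..R} g) UNIV"
proof -
  have "g integrable_on {-R..R}"
    by (rule integrable_continuous_interval[OF continuous_on_subset[OF assms(1)]]) simp
  then have "(g has_integral integral {-R..R} g) {-R..R}"
    by (rule integrable_integral)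
  moreover have "(\<lambda>x. if x \<in> {-R..R} then g x else 0) = g"
    using assms(2) by (auto simp: fun_eq_iff)
  ultimately show ?thesis
    using has_integral_restrict_UNIV[of "{-R..R}" g] by simp
qed

lemma deriv_zero_outside:
  assumes "\<And>x. R < \<bar>x\<bar> \<Longrightarrow> \<phi> x = (0::real)" "R < \<bar>x\<bar>"
  shows "deriv \<phi> x = 0"
proof (rule DERIV_imp_deriv)
  have "(\<phi> has_real_derivative 0) (at x) \<longleftrightarrow> ((\<lambda>x. 0) has_real_derivative 0) (at x)"
  proof (rule DERIV_cong_ev)
    have "open {y. R < \<bar>y::real\<bar>}"
      by (intro open_Collect_less continuous_intros)
    then show "\<forall>\<^sub>F y in nhds x. \<phi> y = 0"
      using assms eventually_nhds_in_open[of "{y. R < \<bar>y\<bar>}" x]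
      by (auto elim!: eventually_mono)
  qed auto
  then show "(\<phi> has_real_derivative 0) (at x)" by simp
qed

lemma integral_deriv_cutoff:
  fixes h :: "real \<Rightarrow> real"
  assumes "\<And>x. x \<in> {a..b} \<Longrightarrow> (h has_real_derivative h' x) (at x)" "a \<le> b" "h a = 0" "h b = 0"
  shows "(h' has_integral 0) {a..b}"
  using fundamental_theorem_of_calculus[of a b h h'] assms
  by (auto simp: has_real_derivative_iff_has_vector_derivative intro: has_vector_derivative_at_within)

section \<open>The du Bois-Reymond lemma\<close>

text \<open>If \<open>D a < c < D b\<close>, take for \<phi>' a narrow bump at \<open>a\<close>
  minus the same bump at \<open>b\<close>. Its mean is zero, so \<phi> has compact support and the
  constant \<open>c\<close> may be subtracted from \<open>D\<close>; then
  \<open>(D - c) \<phi>'\<close> is nonpositive everywhere and negative at \<open>a\<close>, while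
  its integral is zero.\<close>

lemma du_Bois_Reymond:
  fixes D :: "real \<Rightarrow> real"
  assumes cont: "continuous_on UNIV D"
    and test: "\<And>\<phi>. test_fun \<phi> \<Longrightarrow> integral UNIV (\<lambda>x. D x * deriv \<phi> x) = 0"
  shows "D a = D b"
proof (rule ccontr)
  assume "D a \<noteq> D b"
  have False if less: "D a < D b" for a b
  proof -
    define c where "c = (D a + D b) / 2"
    have c: "D a < c" "c < D b"
      using less by (auto simp: c_def)
    have "isCont D a" "isCont D b"
      using cont continuous_on_eq_continuous_at by blast+
    then have "\<forall>\<^sub>F x in at a. D x < c" "\<forall>\<^sub>F x in at b. c < D x"
      using c by (auto simp: isCont_def order_tendsto_iff)
    then have "\<exists>d>0. \<forall>x. x \<noteq> a \<and> dist x a < d \<longrightarrow> D x < c" "\<exists>d>0. \<forall>x. x \<noteq> b \<and> dist x b < d \<longrightarrow> c < D x"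
      unfolding eventually_at by auto
    then obtain d1 d2 where d: "d1 > 0" "d2 > 0" "\<And>x. \<bar>x - a\<bar> < d1 \<Longrightarrow> D x < c"
      "\<And>x. \<bar>x - b\<bar> < d2 \<Longrightarrow> c < D x"
      using c by (metis dist_real_def)
    define e where "e = min d1 d2"
    have e: "e > 0" "\<And>x. \<bar>x - a\<bar> < e \<Longrightarrow> D x < c" "\<And>x. \<bar>x - b\<bar> < e \<Longrightarrow> c < D x"
      using d by (auto simp: e_def)
    obtain \<eta> where \<eta>: "smooth \<eta>" "\<And>x. \<bar>x\<bar> < e \<Longrightarrow> 0 < \<eta> x" "\<And>x. e \<le> \<bar>x\<bar> \<Longrightarrow> \<eta> x = 0"
      using bump_exists[of e] by blast
    obtain H where H: "\<And>x. (H has_real_derivative \<eta> x) (at x)"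
      using antiderivative_real[OF smooth_continuous_on[OF \<eta>(1)]] by blast
    define \<phi> where "\<phi> = (\<lambda>x. H (x - a) - H (x - b))"
    have \<phi>': "(\<phi> has_real_derivative \<eta> (x - a) - \<eta> (x - b)) (at x)" for x
      unfolding \<phi>_def by (rule derivative_eq_intros DERIV_chain2[OF H] refl | simp)+
    have \<eta>_shift: "smooth (\<lambda>x. \<eta> (x - c))" for c
      using smooth_affine[OF \<eta>(1), of 1 "- c"] by simp
    have "smooth \<phi>"
      by (rule smooth_antideriv[OF smooth_diff[OF \<eta>_shift \<eta>_shift] \<phi>'])
    \<comment> \<open>\<open>H\<close> is constant on each side of the support of the bump. Far out,
      \<open>x - a\<close> and \<open>x - b\<close> lie on the same side, so their contributions to
      \<phi> cancel.\<close>
    have H_const: "H x = H y" if "(x \<le> -e \<and> y \<le> -e) \<or> (e \<le> x \<and> e \<le> y)" for x y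
    proof -
      have "H x = H y" if "x < y" "(x \<le> -e \<and> y \<le> -e) \<or> (e \<le> x \<and> e \<le> y)" for x y
      proof (rule DERIV_isconst_end[symmetric, OF \<open>x < y\<close>])
        show "continuous_on {x..y} H"
          using H by (rule DERIV_imp_continuous_on)
        show "DERIV H z :> 0" if "x < z" "z < y" for z
          using H[of z] \<eta>(3)[of z] that \<open>(x \<le> -e \<and> y \<le> -e) \<or> (e \<le> x \<and> e \<le> y)\<close> by auto
      qed
      from this[of x y] this[of y x] that show ?thesis
        by (metis linorder_neqE_linordered_idom)
    qed
    define R where "R = \<bar>a\<bar> + \<bar>b\<bar> + e"
    have \<phi>0: "\<phi> x = 0" if "R < \<bar>x\<bar>" for x
    proof -
      have "(x - a \<le> - e \<and> x - b \<le> - e) \<or> (e \<le> x - a \<and> e \<le> x - b)"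
        using that unfolding R_def by linarith
      then show ?thesis
        unfolding \<phi>_def using H_const by simp
    qed
    have "test_fun \<phi>"
      using \<open>smooth \<phi>\<close> \<phi>0 by (auto simp: test_fun_iff)
    have R: "a \<in> {-R..R}" "b \<in> {-R..R}" "-R < R"
      using e by (auto simp: R_def)
    have deriv_\<phi>: "deriv \<phi> = (\<lambda>x. \<eta> (x - a) - \<eta> (x - b))"
      using \<phi>' by (auto intro: DERIV_imp_deriv)
    have cont': "continuous_on UNIV (\<lambda>x. D x * deriv \<phi> x)"
      by (rule continuous_on_mult[OF cont smooth_continuous_on[OF smooth_deriv[OF \<open>smooth \<phi>\<close>]]])
    have "((\<lambda>x. D x * deriv \<phi> x) has_integral 0) UNIV"
      using continuous_compact_support_integral[OF cont', of R] test[OF \<open>test_fun \<phi>\<close>]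
        deriv_zero_outside[of R \<phi>] \<phi>0
      by (metis (no_types, lifting) integral_unique mult_eq_0_iff)
    moreover have "((\<lambda>x. D x * deriv \<phi> x) has_integral integral {-R..R} (\<lambda>x. D x * deriv \<phi> x)) UNIV"
      by (rule continuous_compact_support_integral[OF cont'])
        (simp add: deriv_zero_outside[of R \<phi>] \<phi>0)
    ultimately have 0: "integral {-R..R} (\<lambda>x. D x * deriv \<phi> x) = 0"
      using has_integral_unique by blast
    have "((\<lambda>x. D x * deriv \<phi> x) has_integral 0) {-R..R}"
      using 0 integrable_continuous_interval[OF continuous_on_subset[OF cont'], of "-R" R]
      by (metis integrable_integral subset_UNIV)
    moreover have "(deriv \<phi> has_integral \<phi> R - \<phi> (-R)) {-R..R}"
      using \<phi>' R by (intro fundamental_theorem_of_calculus)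
        (auto simp: deriv_\<phi> has_real_derivative_iff_has_vector_derivative[symmetric] intro: has_field_derivative_at_within)
    moreover have "\<phi> R = 0" "\<phi> (-R) = 0"
    proof -
      have "e \<le> R - a \<and> e \<le> R - b" "- R - a \<le> - e \<and> - R - b \<le> - e"
        unfolding R_def by linarith+
      then show "\<phi> R = 0" "\<phi> (-R) = 0"
        unfolding \<phi>_def using H_const[of "R - a" "R - b"] H_const[of "-R - a" "-R - b"] by simp_all
    qed
    ultimately have "((\<lambda>x. D x * deriv \<phi> x - c * deriv \<phi> x) has_integral 0 - c * (0 - 0)) {-R..R}"
      by (intro has_integral_diff has_integral_mult_right) auto
    then have int0: "((\<lambda>x. - ((D x - c) * deriv \<phi> x)) has_integral 0) {-R..R}"
      using has_integral_neg[of "\<lambda>x. D x * deriv \<phi> x - c * deriv \<phi> x" 0 "{-R..R}"]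
      by (simp add: algebra_simps)
    have nonneg: "0 \<le> - ((D x - c) * deriv \<phi> x)" for x
    proof -
      have "(D x - c) * \<eta> (x - a) \<le> 0"
        using e(2)[of x] \<eta>(2,3)[of "x - a"] by (cases "\<bar>x - a\<bar> < e") (auto simp: mult_le_0_iff)
      moreover have "(D x - c) * \<eta> (x - b) \<ge> 0"
        using e(3)[of x] \<eta>(2,3)[of "x - b"] by (cases "\<bar>x - b\<bar> < e") (auto)
      ultimately show ?thesis
        by (auto simp: deriv_\<phi> algebra_simps)
    qed
    have "- ((D a - c) * deriv \<phi> a) = 0"
    proof (rule has_integral_0_cbox_imp_0[of "-R" R "\<lambda>x. - ((D x - c) * deriv \<phi> x)" a])
      show "continuous_on (cbox (-R) R) (\<lambda>x. - ((D x - c) * deriv \<phi> x))"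
        by (intro continuous_on_minus continuous_on_mult continuous_on_diff continuous_on_const
            continuous_on_subset[OF cont subset_UNIV] smooth_continuous_on[OF smooth_deriv[OF \<open>smooth \<phi>\<close>]])
    qed (use int0 nonneg R in \<open>auto simp: box_real\<close>)
    moreover have "(D a - c) * \<eta> (a - a) < 0"
      using c \<eta>(2)[of 0] e by (simp add: mult_less_0_iff)
    moreover have "(D a - c) * \<eta> (a - b) \<ge> 0"
      using e(3)[of a] \<eta>(2,3)[of "a - b"] by (cases "\<bar>a - b\<bar> < e") auto
    ultimately show False
      by (auto simp: deriv_\<phi> algebra_simps)
  qed
  from this[of a b] this[of b a] \<open>D a \<noteq> D b\<close> show False
    by linarith
qed

section \<open>Primitives of weighted distributions\<close>

lemma BcD:
  assumes "G \<in> Bc"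
  shows "continuous_on UNIV G" "(G \<longlongrightarrow> 0) at_bot" "\<exists>L. (G \<longlongrightarrow> L) at_top"
  using assms by (auto simp: Bc_def)

lemma Bc_bounded:
  assumes "G \<in> Bc"
  obtains B where "0 < B" "\<And>x. \<bar>G x\<bar> \<le> B"
proof -
  obtain L where L: "(G \<longlongrightarrow> L) at_top"
    using BcD[OF assms] by blast
  have "\<forall>\<^sub>F x in at_bot. \<bar>G x\<bar> < 1"
    using tendsto_rabs[OF BcD(2)[OF assms]] by (rule order_tendstoD) simp
  then obtain a where a: "\<And>x. x \<le> a \<Longrightarrow> \<bar>G x\<bar> < 1"
    by (auto simp: eventually_at_bot_linorder)
  have "\<forall>\<^sub>F x in at_top. \<bar>G x\<bar> < \<bar>L\<bar> + 1"
    using tendsto_rabs[OF L] by (rule order_tendstoD) simp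
  then obtain b where b: "\<And>x. b \<le> x \<Longrightarrow> \<bar>G x\<bar> < \<bar>L\<bar> + 1"
    by (auto simp: eventually_at_top_linorder)
  have "bounded (G ` {a..b})"
    using BcD(1)[OF assms] by (intro compact_imp_bounded compact_continuous_image) (auto intro: continuous_on_subset)
  then obtain M where M: "\<And>x. x \<in> {a..b} \<Longrightarrow> \<bar>G x\<bar> \<le> M"
    unfolding bounded_iff by (metis imageI real_norm_def)
  show ?thesis
  proof (rule that)
    show "0 < \<bar>M\<bar> + \<bar>L\<bar> + 1" by linarith
    show "\<bar>G x\<bar> \<le> \<bar>M\<bar> + \<bar>L\<bar> + 1" for x
      using a[of x] b[of x] M[of x] by (cases "x \<le> a"; cases "b \<le> x") auto
  qed
qed

text \<open>Let the left end point tend to minus infinity, where \<open>G\<close> vanishes.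
  Boundedness of \<open>G\<close> comes first because a real \<open>SUP\<close> is meaningful only
  for a set bounded above.\<close>

lemma abs_le_alex_norm:
  assumes "G \<in> Bc"
  shows "\<bar>G x\<bar> \<le> alex_norm G"
proof -
  obtain B where B: "\<And>x. \<bar>G x\<bar> \<le> B"
    using Bc_bounded[OF assms] by blast
  have "bdd_above ((\<lambda>p. \<bar>G (snd p) - G (fst p)\<bar>) ` {p::real\<times>real. fst p < snd p})"
  proof (rule bdd_aboveI2)
    fix p :: "real \<times> real"
    show "\<bar>G (snd p) - G (fst p)\<bar> \<le> 2 * B"
      using B[of "fst p"] B[of "snd p"] by linarith
  qed
  then have le: "\<bar>G x - G y\<bar> \<le> alex_norm G" if "y < x" for y
    unfolding alex_norm_def using that by (intro cSUP_upper2[where x = "(y, x)"]) auto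
  have "((\<lambda>y. \<bar>G x - G y\<bar>) \<longlongrightarrow> \<bar>G x - 0\<bar>) at_bot"
    by (intro tendsto_intros BcD(2)[OF assms])
  then have "\<bar>G x - 0\<bar> \<le> alex_norm G"
    by (rule tendsto_upperbound) (use le in \<open>auto intro: eventually_mono[OF eventually_gt_at_bot]\<close>)
  then show ?thesis by simp
qed

lemma alex_norm_nonneg: "G \<in> Bc \<Longrightarrow> 0 \<le> alex_norm G"
  using abs_le_alex_norm[of G 0] by linarith

lemma Bc_diff:
  assumes "F \<in> Bc" "G \<in> Bc"
  shows "(\<lambda>x. F x - G x) \<in> Bc"
proof -
  obtain K L where "(F \<longlongrightarrow> K) at_top" "(G \<longlongrightarrow> L) at_top"
    using BcD(3)[OF assms(1)] BcD(3)[OF assms(2)] by blast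
  then have "((\<lambda>x. F x - G x) \<longlongrightarrow> K - L) at_top"
    by (rule tendsto_diff)
  moreover have "((\<lambda>x. F x - G x) \<longlongrightarrow> 0 - 0) at_bot"
    by (intro tendsto_diff BcD assms)
  moreover have "continuous_on UNIV (\<lambda>x. F x - G x)"
    by (intro continuous_on_diff BcD(1) assms)
  ultimately show ?thesis
    unfolding Bc_def by auto
qed

lemma test_funE:
  assumes "test_fun \<phi>"
  obtains R where "smooth \<phi>" "\<And>x. R < \<bar>x\<bar> \<Longrightarrow> \<phi> x = 0" "\<And>x. R < \<bar>x\<bar> \<Longrightarrow> deriv \<phi> x = 0"
proof -
  obtain R where R: "\<And>x. R < \<bar>x\<bar> \<Longrightarrow> \<phi> x = 0"
    using assms by (auto simp: test_fun_iff)
  show ?thesis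
    by (rule that[of R]) (use assms R deriv_zero_outside[of R \<phi>] in \<open>auto simp: test_fun_iff\<close>)
qed

lemma test_fun_integral_deriv:
  fixes G G' :: "real \<Rightarrow> real"
  assumes "test_fun \<phi>" and G: "\<And>x. (G has_real_derivative G' x) (at x)" and G': "continuous_on UNIV G'"
  shows "integral UNIV (\<lambda>x. G' x * \<phi> x) = - integral UNIV (\<lambda>x. G x * deriv \<phi> x)"
proof -
  obtain R0 where \<phi>: "smooth \<phi>" "\<And>x. R0 < \<bar>x\<bar> \<Longrightarrow> \<phi> x = 0" "\<And>x. R0 < \<bar>x\<bar> \<Longrightarrow> deriv \<phi> x = 0"
    using test_funE[OF assms(1)] by blast
  define R where "R = \<bar>R0\<bar> + 1"
  have R: "-R < R" "\<phi> R = 0" "\<phi> (-R) = 0"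
    using \<phi> by (auto simp: R_def)
  have contG: "continuous_on UNIV G"
    using G by (rule DERIV_imp_continuous_on)
  have 1: "((\<lambda>x. G' x * \<phi> x) has_integral integral {-R..R} (\<lambda>x. G' x * \<phi> x)) UNIV"
    by (rule continuous_compact_support_integral)
      (use \<phi> in \<open>auto intro!: continuous_on_mult[OF G' smooth_continuous_on] simp: R_def\<close>)
  have 2: "((\<lambda>x. G x * deriv \<phi> x) has_integral integral {-R..R} (\<lambda>x. G x * deriv \<phi> x)) UNIV"
    by (rule continuous_compact_support_integral)
      (use \<phi> in \<open>auto intro!: continuous_on_mult[OF contG smooth_continuous_on] smooth_deriv simp: R_def\<close>)
  have "((\<lambda>x. G' x * \<phi> x + deriv \<phi> x * G x) has_integral 0) {-R..R}"
    by (rule integral_deriv_cutoff[where h = "\<lambda>x. G x * \<phi> x"])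
      (use R in \<open>auto intro!: DERIV_mult G smooth_DERIV \<phi>\<close>)
  then have "integral {-R..R} (\<lambda>x. G' x * \<phi> x + G x * deriv \<phi> x) = 0"
    by (simp add: integral_unique mult.commute)
  moreover have "(\<lambda>x. G' x * \<phi> x) integrable_on {-R..R}" "(\<lambda>x. G x * deriv \<phi> x) integrable_on {-R..R}"
    by (intro integrable_continuous_interval continuous_on_mult continuous_on_subset[OF G' subset_UNIV]
        continuous_on_subset[OF contG subset_UNIV] smooth_continuous_on[OF \<phi>(1)]
        smooth_continuous_on[OF smooth_deriv[OF \<phi>(1)]])+
  ultimately show ?thesis
    using integral_unique[OF 1] integral_unique[OF 2]
    by (simp add: integral_add)
qed

lemma integral_test_diff:
  fixes F G :: "real \<Rightarrow> real"
  assumes "test_fun \<phi>" "continuous_on UNIV F" "continuous_on UNIV G"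
  shows "integral UNIV (\<lambda>x. (F x - G x) * deriv \<phi> x) =
      integral UNIV (\<lambda>x. F x * deriv \<phi> x) - integral UNIV (\<lambda>x. G x * deriv \<phi> x)"
proof -
  obtain R where \<phi>: "smooth \<phi>" "\<And>x. R < \<bar>x\<bar> \<Longrightarrow> \<phi> x = 0" "\<And>x. R < \<bar>x\<bar> \<Longrightarrow> deriv \<phi> x = 0"
    using test_funE[OF assms(1)] by blast
  have "(\<lambda>x. F x * deriv \<phi> x) integrable_on UNIV" if "continuous_on UNIV F" for F
    using continuous_compact_support_integral[of "\<lambda>x. F x * deriv \<phi> x" R] that \<phi>
      smooth_continuous_on[OF smooth_deriv[OF \<phi>(1)]]
    by (auto simp: integrable_on_def intro!: continuous_intros)
  then show ?thesis
    using assms by (simp add: left_diff_distrib integral_diff)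
qed

lemma Bc_eqI:
  assumes "F \<in> Bc" "G \<in> Bc"
    and "\<And>\<phi>. test_fun \<phi> \<Longrightarrow> integral UNIV (\<lambda>x. F x * deriv \<phi> x) = integral UNIV (\<lambda>x. G x * deriv \<phi> x)"
  shows "F = G"
proof
  fix x
  have "F x - G x = F y - G y" for y
    by (rule du_Bois_Reymond) (use assms in \<open>auto intro!: continuous_intros simp: BcD integral_test_diff\<close>)
  then have "(\<lambda>y. F y - G y) = (\<lambda>y. F x - G x)"
    by (intro ext) (rule sym)
  moreover have "((\<lambda>y. F y - G y) \<longlongrightarrow> 0 - 0) at_bot"
    by (intro tendsto_intros BcD assms)
  ultimately show "F x = G x"
    by (simp add: tendsto_const_iff)
qed

text \<open>Both primitives have the same pairings with all \<phi>', so they differ by a constant,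
  and the limit 0 at minus infinity fixes it. This gives the \<open>THE\<close> in
  \<open>wnorm\<close> and \<open>heat_conv\<close> its meaning.\<close>

lemma acprim_unique: "acprim \<sigma> f F \<Longrightarrow> acprim \<sigma> f G \<Longrightarrow> F = G"
  unfolding acprim_def by (rule Bc_eqI) auto

lemma The_acprim: "acprim \<sigma> f G \<Longrightarrow> (THE G. acprim \<sigma> f G) = G"
  using acprim_unique by blast

lemma wnorm_eq: "acprim \<sigma> f G \<Longrightarrow> wnorm \<sigma> f = alex_norm G"
  by (simp add: wnorm_def The_acprim)

lemma acprim_diff:
  assumes "acprim \<sigma> f F" "acprim \<sigma> g G"
  shows "acprim \<sigma> (\<lambda>\<phi>. f \<phi> - g \<phi>) (\<lambda>x. F x - G x)"
  using assms unfolding acprim_def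
  by (auto simp: Bc_diff BcD integral_test_diff)

lemma continuous_on_omega: "continuous_on S (omega \<sigma>)"
  \<comment> \<open>For \<open>\<sigma> = 0\<close> division by zero makes \<open>omega\<close> the
    constant 1.\<close>
  by (cases "\<sigma> = 0") (auto simp: omega_def[abs_def] intro!: continuous_intros)

lemma omega_pos [simp]: "0 < omega \<sigma> x"
  by (simp add: omega_def)

text \<open>Passage from distributions to calculus: an ordinary antiderivative of
  \<open>g \<omega>\<^sub>\<sigma>\<close> has the same pairings with all \<phi>' as
  \<open>G\<close>, hence differs from it by a constant.\<close>

lemma acprim_fun_dist_DERIV:
  assumes "acprim \<sigma> (fun_dist g) G" and cont: "continuous_on UNIV g"
  shows "(G has_real_derivative g x * omega \<sigma> x) (at x)"
proof -
  have G: "G \<in> Bc" and test: "\<And>\<phi>. test_fun \<phi> \<Longrightarrow>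
      integral UNIV (\<lambda>x. g x * (omega \<sigma> x * \<phi> x)) = - integral UNIV (\<lambda>x. G x * deriv \<phi> x)"
    using assms(1) by (auto simp: acprim_def fun_dist_def)
  have cont': "continuous_on UNIV (\<lambda>x. g x * omega \<sigma> x)"
    by (intro continuous_intros cont continuous_on_omega)
  obtain P where P: "\<And>x. (P has_real_derivative g x * omega \<sigma> x) (at x)"
    using antiderivative_real[OF cont'] by blast
  have "continuous_on UNIV P"
    using P by (rule DERIV_imp_continuous_on)
  have "G y - P y = G 0 - P 0" for y
  proof (rule du_Bois_Reymond[where D = "\<lambda>x. G x - P x"])
    show "continuous_on UNIV (\<lambda>x. G x - P x)"
      by (rule continuous_on_diff[OF BcD(1)[OF G] \<open>continuous_on UNIV P\<close>])
    show "integral UNIV (\<lambda>x. (G x - P x) * deriv \<phi> x) = 0" if "test_fun \<phi>" for \<phi>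
      using test[OF that] test_fun_integral_deriv[OF that P cont']
        integral_test_diff[OF that BcD(1)[OF G] \<open>continuous_on UNIV P\<close>]
      by (simp add: mult.assoc)
  qed
  then have "G = (\<lambda>x. P x + (G 0 - P 0))"
    by (metis (no_types) add.commute diff_add_cancel)
  moreover have "((\<lambda>x. P x + (G 0 - P 0)) has_real_derivative g x * omega \<sigma> x) (at x)"
    by (rule derivative_eq_intros P refl | simp)+
  ultimately show ?thesis by simp
qed

section \<open>Gaussian factors and change of weight\<close>

text \<open>A Cauchy criterion controlled by the increments of a convergent function. The limit is
  found along the integers; letting \<open>y\<close> run through them in the hypothesis then gives
  \<open>\<bar>L - q x\<bar> \<le> B * r x\<close> for real \<open>x \<ge> 0\<close>.\<close>

lemma tendsto_at_top_of_dominated_increments: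
  fixes q r :: "real \<Rightarrow> real"
  assumes incr: "\<And>x y. 0 \<le> x \<Longrightarrow> x \<le> y \<Longrightarrow> \<bar>q y - q x\<bar> \<le> B * (r x - r y)"
    and r: "(r \<longlongrightarrow> 0) at_top"
  shows "\<exists>L. (q \<longlongrightarrow> L) at_top"
proof -
  have q_r: "\<bar>q y - q x\<bar> \<le> \<bar>B * (r x - r y)\<bar>" if "0 \<le> x" "0 \<le> y" for x y
    using incr[of x y] incr[of y x] that by (cases "x \<le> y") (auto simp: right_diff_distrib)
  have rn: "(\<lambda>n. B * r (real n)) \<longlonglongrightarrow> B * 0"
    by (intro tendsto_mult tendsto_const filterlim_compose[OF r filterlim_real_sequentially])
  then have "Cauchy (\<lambda>n. B * r (real n))"
    by (rule LIMSEQ_imp_Cauchy)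
  have "Cauchy (\<lambda>n. q (real n))"
  proof (rule CauchyI)
    fix e :: real assume "0 < e"
    then obtain M where M: "\<And>m n. M \<le> m \<Longrightarrow> M \<le> n \<Longrightarrow> norm (B * r (real m) - B * r (real n)) < e"
      using CauchyD[OF \<open>Cauchy (\<lambda>n. B * r (real n))\<close>] by blast
    show "\<exists>M. \<forall>m\<ge>M. \<forall>n\<ge>M. norm (q (real m) - q (real n)) < e"
    proof (intro exI allI impI)
      fix m n assume "M \<le> m" "M \<le> n"
      then show "norm (q (real m) - q (real n)) < e"
        using q_r[of "real n" "real m"] M[of m n] M[of n m] by (simp add: right_diff_distrib)
    qed
  qed
  then obtain L where L: "(\<lambda>n. q (real n)) \<longlonglongrightarrow> L"
    using Cauchy_convergent_iff convergent_def by blast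
  have bound: "\<bar>L - q x\<bar> \<le> B * r x" if "0 \<le> x" for x
  proof (rule LIMSEQ_le)
    show "(\<lambda>n. \<bar>q (real n) - q x\<bar>) \<longlonglongrightarrow> \<bar>L - q x\<bar>"
      by (intro tendsto_intros L)
    show "(\<lambda>n. B * r x - B * r (real n)) \<longlonglongrightarrow> B * r x"
      using tendsto_diff[OF tendsto_const rn, of "B * r x"] by simp
    show "\<exists>N. \<forall>n\<ge>N. \<bar>q (real n) - q x\<bar> \<le> B * r x - B * r (real n)"
    proof (intro exI[of _ "nat \<lceil>x\<rceil>"] allI impI)
      fix n assume "nat \<lceil>x\<rceil> \<le> n"
      then have "x \<le> real n" by linarith
      then show "\<bar>q (real n) - q x\<bar> \<le> B * r x - B * r (real n)"
        using incr[OF that] by (simp add: right_diff_distrib)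
    qed
  qed
  have "((\<lambda>x. L - q x) \<longlongrightarrow> 0) at_top"
  proof (rule tendsto_0_le)
    show "((\<lambda>x. B * r x) \<longlongrightarrow> 0) at_top"
      using tendsto_mult[OF tendsto_const r, of B] by simp
    show "\<forall>\<^sub>F x in at_top. norm (L - q x) \<le> norm (B * r x) * 1"
      using bound by (intro eventually_mono[OF eventually_ge_at_top[of 0]]) force
  qed
  then have "((\<lambda>x. L - (L - q x)) \<longlongrightarrow> L - 0) at_top"
    by (intro tendsto_intros)
  then show ?thesis by auto
qed

lemma DERIV_gaussian: "((\<lambda>x. exp (- c * x\<^sup>2)) has_real_derivative - 2 * c * x * exp (- c * x\<^sup>2)) (at x)"
  by (rule derivative_eq_intros refl | simp)+

lemma gaussian_at_top:
  assumes "0 < c"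
  shows "((\<lambda>x::real. exp (- c * x\<^sup>2)) \<longlongrightarrow> 0) at_top"
  using assms by real_asymp

lemma gaussian_at_bot:
  assumes "0 < c"
  shows "((\<lambda>x::real. exp (- c * x\<^sup>2)) \<longlongrightarrow> 0) at_bot"
  using assms by real_asymp

text \<open>On \<open>x \<ge> 0\<close> the function \<open>r = exp (- c * x\<^sup>2)\<close>
  decreases, so \<open>\<bar>F\<bar> \<le> B\<close> makes both \<open>B r + Q\<close> and
  \<open>B r - Q\<close> nonincreasing; together they say that the increments of \<open>Q\<close>
  are dominated by those of \<open>B r\<close>.\<close>

lemma gaussian_antideriv_tendsto:
  assumes Q: "\<And>x. (Q has_real_derivative F x * (- 2 * c * x * exp (- c * x\<^sup>2))) (at x)"
    and F: "\<And>x. \<bar>F x\<bar> \<le> B" and "0 < c"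
  shows "\<exists>L. (Q \<longlongrightarrow> L) at_top"
proof (rule tendsto_at_top_of_dominated_increments)
  show "((\<lambda>x::real. exp (- c * x\<^sup>2)) \<longlongrightarrow> 0) at_top"
    by (rule gaussian_at_top[OF \<open>0 < c\<close>])
  let ?r = "\<lambda>x. exp (- c * x\<^sup>2)"
  fix x y :: real assume "0 \<le> x" "x \<le> y"
  have neg: "(B + k * F z) * (- 2 * c * z * ?r z) \<le> 0" if "0 \<le> z" "\<bar>k\<bar> = 1" for z k
  proof -
    have "0 \<le> B + k * F z"
      using F[of z] \<open>\<bar>k\<bar> = 1\<close> by (auto simp: abs_if split: if_splits)
    then show ?thesis
      using that \<open>0 < c\<close> by (simp add: mult_le_0_iff zero_le_mult_iff)
  qed
  have "B * ?r y + k * Q y \<le> B * ?r x + k * Q x" if "\<bar>k\<bar> = 1" for k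
  proof (rule DERIV_nonpos_imp_nonincreasing[OF \<open>x \<le> y\<close>, where f = "\<lambda>x. B * ?r x + k * Q x"])
    fix z assume "x \<le> z" "z \<le> y"
    have "((\<lambda>x. B * ?r x + k * Q x) has_real_derivative
        (B + k * F z) * (- 2 * c * z * ?r z)) (at z)"
      by (rule derivative_eq_intros Q DERIV_gaussian refl | simp add: algebra_simps)+
    then show "\<exists>D. ((\<lambda>x. B * ?r x + k * Q x) has_real_derivative D) (at z) \<and> D \<le> 0"
      using neg[OF _ that] \<open>0 \<le> x\<close> \<open>x \<le> z\<close> by (meson order_trans)
  qed
  from this[of 1] this[of "-1"] show "\<bar>Q y - Q x\<bar> \<le> B * (?r x - ?r y)"
    by (simp add: algebra_simps abs_le_iff)
qed

lemma gaussian_antideriv_tendsto_at_bot: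
  assumes Q: "\<And>x. (Q has_real_derivative F x * (- 2 * c * x * exp (- c * x\<^sup>2))) (at x)"
    and F: "\<And>x. \<bar>F x\<bar> \<le> B" and "0 < c"
  shows "\<exists>L. (Q \<longlongrightarrow> L) at_bot"
proof -
  have "\<exists>L. ((\<lambda>x. Q (- x)) \<longlongrightarrow> L) at_top"
  proof (rule gaussian_antideriv_tendsto[where F = "\<lambda>x. F (- x)" and c = c and B = B])
    fix x
    show "((\<lambda>x. Q (- x)) has_real_derivative F (- x) * (- 2 * c * x * exp (- c * x\<^sup>2))) (at x)"
      using DERIV_chain2[OF Q[of "- x"] DERIV_minus[OF DERIV_ident]] by simp
  qed (use assms in auto)
  then show ?thesis
    by (simp add: filterlim_at_bot_mirror)
qed

lemma omega_change_weight:
  assumes "0 < \<sigma>" "0 < \<tau>"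
  shows "omega \<sigma> x = omega \<tau> x * exp (- (1 / (4 * \<sigma>) - 1 / (4 * \<tau>)) * x\<^sup>2)"
  unfolding omega_def exp_add[symmetric] using assms by (simp add: field_simps)

text \<open>With \<open>r = \<omega>\<^sub>\<sigma> / \<omega>\<^sub>\<tau>\<close> the product rule
  reads \<open>F' r = (F r)' - F r'\<close>, so \<open>F r\<close> minus an antiderivative of
  \<open>F r'\<close> is the new primitive. The explicit form is part of the conclusion because
  \<open>localized_change_weight\<close> computes with it.\<close>

lemma acprim_change_weight:
  assumes f: "acprim \<tau> f F" and "0 < \<sigma>" "\<sigma> < \<tau>"
  defines "c \<equiv> 1 / (4 * \<sigma>) - 1 / (4 * \<tau>)"
  obtains Q where "\<And>x. (Q has_real_derivative F x * (- 2 * c * x * exp (- c * x\<^sup>2))) (at x)"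
    and "acprim \<sigma> f (\<lambda>x. F x * exp (- c * x\<^sup>2) - Q x)"
proof -
  let ?r = "\<lambda>x. exp (- c * x\<^sup>2)" and ?r' = "\<lambda>x. - 2 * c * x * exp (- c * x\<^sup>2)"
  have c: "0 < c"
    using assms by (simp add: c_def field_simps)
  have F: "F \<in> Bc" and test: "\<And>\<phi>. test_fun \<phi> \<Longrightarrow>
      f (\<lambda>x. omega \<tau> x * \<phi> x) = - integral UNIV (\<lambda>x. F x * deriv \<phi> x)"
    using f by (auto simp: acprim_def)
  note contF = BcD(1)[OF F]
  obtain B where B: "\<And>x. \<bar>F x\<bar> \<le> B"
    using Bc_bounded[OF F] by blast
  have cont': "continuous_on UNIV (\<lambda>x. F x * ?r' x)"
    by (intro continuous_intros contF)
  obtain P where P: "\<And>x. (P has_real_derivative F x * ?r' x) (at x)"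
    using antiderivative_real[OF cont'] by blast
  obtain L where L: "(P \<longlongrightarrow> L) at_bot"
    using gaussian_antideriv_tendsto_at_bot[OF P B c] by blast
  obtain M where M: "(P \<longlongrightarrow> M) at_top"
    using gaussian_antideriv_tendsto[OF P B c] by blast
  \<comment> \<open>Normalized to vanish at minus infinity, as membership of the new primitive in
    \<open>Bc\<close> demands.\<close>
  define Q where "Q x = P x - L" for x
  have Q: "(Q has_real_derivative F x * ?r' x) (at x)" for x
    unfolding Q_def[abs_def] by (rule derivative_eq_intros P refl | simp)+
  have contQ: "continuous_on UNIV Q"
    using Q by (rule DERIV_imp_continuous_on)
  define G where "G x = F x * ?r x - Q x" for x
  have contG: "continuous_on UNIV G"
    unfolding G_def[abs_def] by (intro continuous_intros contF contQ)
  obtain K where K: "(F \<longlongrightarrow> K) at_top"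
    using BcD(3)[OF F] by blast
  have "(G \<longlongrightarrow> 0 * 0 - (L - L)) at_bot" "(G \<longlongrightarrow> K * 0 - (M - L)) at_top"
    unfolding G_def[abs_def] Q_def[abs_def]
    by (intro tendsto_diff tendsto_mult tendsto_const BcD(2)[OF F] gaussian_at_bot[OF c] L K M gaussian_at_top[OF c])+
  with contG have G: "G \<in> Bc"
    unfolding Bc_def by auto
  have "f (\<lambda>x. omega \<sigma> x * \<phi> x) = - integral UNIV (\<lambda>x. G x * deriv \<phi> x)" if \<phi>: "test_fun \<phi>" for \<phi>
  proof -
    obtain R where R: "smooth \<phi>" "\<And>x. R < \<bar>x\<bar> \<Longrightarrow> \<phi> x = 0" "\<And>x. R < \<bar>x\<bar> \<Longrightarrow> deriv \<phi> x = 0"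
      using test_funE[OF \<phi>] by blast
    \<comment> \<open>\<open>\<omega>\<^sub>\<sigma> \<phi> = \<omega>\<^sub>\<tau> (r
      \<phi>)\<close>, and \<open>r \<phi>\<close> is again a test function, so the defining
      identity for the weight \<tau> applies to it.\<close>
    have "test_fun (\<lambda>x. ?r x * \<phi> x)"
      unfolding test_fun_iff using R smooth_mult[OF smooth_gaussian] by fastforce
    moreover have "(\<lambda>x. omega \<sigma> x * \<phi> x) = (\<lambda>x. omega \<tau> x * (?r x * \<phi> x))"
      using assms omega_change_weight[of \<sigma> \<tau>] by (auto simp: c_def)
    moreover have "deriv (\<lambda>x. ?r x * \<phi> x) = (\<lambda>x. ?r' x * \<phi> x + deriv \<phi> x * ?r x)"
      by (rule ext, rule DERIV_imp_deriv, rule DERIV_mult[OF DERIV_gaussian smooth_DERIV[OF R(1)]])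
    ultimately have "f (\<lambda>x. omega \<sigma> x * \<phi> x) = - integral UNIV (\<lambda>x. (F x * ?r' x) * \<phi> x + (F x * ?r x) * deriv \<phi> x)"
      using test[of "\<lambda>x. ?r x * \<phi> x"] by (simp add: algebra_simps)
    also have "integral UNIV (\<lambda>x. (F x * ?r' x) * \<phi> x + (F x * ?r x) * deriv \<phi> x) =
        integral UNIV (\<lambda>x. (F x * ?r' x) * \<phi> x) + integral UNIV (\<lambda>x. (F x * ?r x) * deriv \<phi> x)"
    proof (rule integral_add)
      have "continuous_on UNIV (\<lambda>x. (F x * ?r' x) * \<phi> x)"
        by (rule continuous_on_mult[OF cont' smooth_continuous_on[OF R(1)]])
      from continuous_compact_support_integral[OF this, of R] R(2)
      show "(\<lambda>x. (F x * ?r' x) * \<phi> x) integrable_on UNIV"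
        by auto
      have "continuous_on UNIV (\<lambda>x. (F x * ?r x) * deriv \<phi> x)"
        by (intro continuous_on_mult[OF _ smooth_continuous_on[OF smooth_deriv[OF R(1)]]] continuous_intros contF)
      from continuous_compact_support_integral[OF this, of R] R(3)
      show "(\<lambda>x. (F x * ?r x) * deriv \<phi> x) integrable_on UNIV"
        by auto
    qed
    also have "integral UNIV (\<lambda>x. (F x * ?r' x) * \<phi> x) = - integral UNIV (\<lambda>x. Q x * deriv \<phi> x)"
      by (rule test_fun_integral_deriv[OF \<phi> Q cont'])
    finally show ?thesis
      using integral_test_diff[OF \<phi>, of "\<lambda>x. F x * ?r x" Q] contQ
      by (simp add: G_def[abs_def] continuous_on_mult contF continuous_intros)
  qed
  with G have "acprim \<sigma> f G"
    by (simp add: acprim_def)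
  with Q show ?thesis
    unfolding G_def[abs_def] by (rule that)
qed

section \<open>The localized heat kernel\<close>

text \<open>The cutoff lives on \<open>{-R..R}\<close> with \<open>a = 1 / R ^ 4\<close>. Its fourth-order zeros at the
  end points remove all boundary terms, and since it is \<open>1 + O(z ^ 4)\<close> at the centre, its derivatives
  compensate the singularity of the heat kernel at \<open>z = 0\<close> as the time variable tends to \<open>0\<close>.\<close>
definition cutoff :: "real \<Rightarrow> real \<Rightarrow> real" where
  "cutoff a z = (1 - a * z ^ 4) ^ 4"

definition cutoff1 :: "real \<Rightarrow> real \<Rightarrow> real" where
  "cutoff1 a z = - 16 * a * z ^ 3 * (1 - a * z ^ 4) ^ 3"

definition cutoff2 :: "real \<Rightarrow> real \<Rightarrow> real" where
  "cutoff2 a z = - 48 * a * z\<^sup>2 * (1 - a * z ^ 4) ^ 3 + 192 * a\<^sup>2 * z ^ 6 * (1 - a * z ^ 4)\<^sup>2"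

definition cutoff3 :: "real \<Rightarrow> real \<Rightarrow> real" where
  "cutoff3 a z = - 96 * a * z * (1 - a * z ^ 4) ^ 3 + 1728 * a\<^sup>2 * z ^ 5 * (1 - a * z ^ 4)\<^sup>2
     - 1536 * a ^ 3 * z ^ 9 * (1 - a * z ^ 4)"

lemma DERIV_cutoff: "(cutoff a has_real_derivative cutoff1 a z) (at z)"
  unfolding cutoff_def[abs_def] cutoff1_def
  by (rule derivative_eq_intros refl | simp)+

lemma DERIV_cutoff1: "(cutoff1 a has_real_derivative cutoff2 a z) (at z)"
  unfolding cutoff1_def[abs_def] cutoff2_def
  by (rule derivative_eq_intros refl)+ (simp add: eval_nat_numeral algebra_simps)

lemma DERIV_cutoff2: "(cutoff2 a has_real_derivative cutoff3 a z) (at z)"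
  unfolding cutoff2_def[abs_def] cutoff3_def
  by (rule derivative_eq_intros refl)+ (simp add: eval_nat_numeral algebra_simps)

text \<open>Both \<open>p = 1 - a z^4\<close> and \<open>a z^4\<close> lie in [0, 1], so once a
  power of \<open>z\<close> is factored out every remaining monomial is at most 1. The constants are
  sums of absolute coefficients: 240 = 48 + 192 and 3360 = 96 + 1728 + 1536.\<close>

lemma cutoff_bounds:
  assumes "0 \<le> a" "a * z ^ 4 \<le> 1"
  shows "0 \<le> cutoff a z" "cutoff a z \<le> 1" "\<bar>cutoff1 a z\<bar> \<le> 16 * a * \<bar>z\<bar> ^ 3"
    "\<bar>cutoff2 a z\<bar> \<le> 240 * a * \<bar>z\<bar>\<^sup>2" "\<bar>cutoff3 a z\<bar> \<le> 3360 * a * \<bar>z\<bar>"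
proof -
  define p where "p = 1 - a * z ^ 4"
  have p: "0 \<le> p" "p \<le> 1" "0 \<le> a * z ^ 4"
    using assms by (auto simp: p_def)
  have pk: "0 \<le> p ^ k" "p ^ k \<le> 1" for k
    using p by (auto intro: power_le_one)
  have m: "(a * z ^ 4) ^ j * p ^ k \<le> 1" "0 \<le> (a * z ^ 4) ^ j * p ^ k" for j k
    using assms p by (auto intro!: mult_le_one power_le_one)
  show "0 \<le> cutoff a z" "cutoff a z \<le> 1"
    using pk by (auto simp: cutoff_def p_def)
  have "\<bar>cutoff1 a z\<bar> = 16 * a * \<bar>z\<bar> ^ 3 * p ^ 3"
    using assms pk[of 3] by (simp add: cutoff1_def p_def[symmetric] abs_mult power_abs)
  also have "\<dots> \<le> 16 * a * \<bar>z\<bar> ^ 3 * 1"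
    using pk[of 3] assms by (intro mult_left_mono) auto
  finally show "\<bar>cutoff1 a z\<bar> \<le> 16 * a * \<bar>z\<bar> ^ 3" by simp
  have "cutoff2 a z = (a * \<bar>z\<bar>\<^sup>2) * (- 48 * p ^ 3 + 192 * ((a * z ^ 4) ^ 1 * p\<^sup>2))"
    unfolding cutoff2_def p_def[symmetric] by (simp add: eval_nat_numeral algebra_simps)
  also have "\<bar>\<dots>\<bar> \<le> (a * \<bar>z\<bar>\<^sup>2) * 240"
  proof -
    have "\<bar>- 48 * p ^ 3 + 192 * ((a * z ^ 4) ^ 1 * p\<^sup>2)\<bar> \<le> 240"
      using pk[of 3] m[of 1 2] by linarith
    then show ?thesis
      unfolding abs_mult using assms by (intro mult_mono) auto
  qed
  finally show "\<bar>cutoff2 a z\<bar> \<le> 240 * a * \<bar>z\<bar>\<^sup>2" by simp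
  have "cutoff3 a z = (a * z) * (- 96 * p ^ 3 + 1728 * ((a * z ^ 4) ^ 1 * p\<^sup>2) - 1536 * ((a * z ^ 4) ^ 2 * p ^ 1))"
    unfolding cutoff3_def p_def[symmetric] by (simp add: eval_nat_numeral algebra_simps)
  also have "\<bar>\<dots>\<bar> \<le> (a * \<bar>z\<bar>) * 3360"
  proof -
    have "\<bar>- 96 * p ^ 3 + 1728 * ((a * z ^ 4) ^ 1 * p\<^sup>2) - 1536 * ((a * z ^ 4)\<^sup>2 * p ^ 1)\<bar> \<le> 3360"
      using pk[of 3] m[of 1 2] m[of 2 1] by linarith
    then show ?thesis
      unfolding abs_mult using assms by (intro mult_mono) auto
  qed
  finally show "\<bar>cutoff3 a z\<bar> \<le> 3360 * a * \<bar>z\<bar>" by simp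
qed

section \<open>Estimates for the weighted kernel and the error term\<close>

lemma DERIV_Theta: "s \<noteq> 0 \<Longrightarrow> (Theta s has_real_derivative - z / (2 * s) * Theta s z) (at z)"
  unfolding Theta_def[abs_def]
  by (rule derivative_eq_intros refl | simp add: field_simps)+

lemma Theta_pos: "0 < s \<Longrightarrow> 0 < Theta s z"
  by (simp add: Theta_def)

text \<open>In the variable \<open>z = \<xi> - x\<close> this is the multiplier of the convolution.
  For every weight, \<open>g \<omega>\<^sub>\<sigma>\<close> times this multiplier is
  \<open>g\<close> times the heat kernel centred at \<open>x\<close>.\<close>

definition weighted_kernel :: "real \<Rightarrow> real \<Rightarrow> real \<Rightarrow> real \<Rightarrow> real" where
  "weighted_kernel x \<sigma> s z = Theta s z / omega \<sigma> (x + z)"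

lemma DERIV_weighted_kernel:
  assumes "s \<noteq> 0" "\<sigma> \<noteq> 0"
  shows "(weighted_kernel x \<sigma> s has_real_derivative
      weighted_kernel x \<sigma> s z * ((x + z) / (2 * \<sigma>) - z / (2 * s))) (at z)"
proof -
  have E: "((\<lambda>z. exp ((x + z)\<^sup>2 / (4 * \<sigma>))) has_real_derivative
      exp ((x + z)\<^sup>2 / (4 * \<sigma>)) * ((x + z) / (2 * \<sigma>))) (at z)"
    using assms by (auto intro!: derivative_eq_intros simp: field_simps)
  have eq: "weighted_kernel x \<sigma> s = (\<lambda>z. Theta s z * exp ((x + z)\<^sup>2 / (4 * \<sigma>)))"
    by (auto simp: weighted_kernel_def[abs_def] omega_def exp_minus field_simps)
  show ?thesis
    unfolding eq using DERIV_mult[OF DERIV_Theta[OF assms(1)] E]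
    by (rule DERIV_cong) (simp add: algebra_simps)
qed

lemma weighted_kernel_pos: "0 < s \<Longrightarrow> 0 < weighted_kernel x \<sigma> s z"
  by (simp add: weighted_kernel_def Theta_pos)

text \<open>Young's inequality \<open>(x + z)^2 \<le> (1 + e) z^2 + (1 + 1/e) x^2\<close> separates
  the centre from the variable: the \<open>x\<close> part goes into \<open>A\<close>, and
  \<open>z^2 / s\<close> keeps the coefficient
  \<open>- (\<delta> - e s) / (4 (s + \<delta>))\<close>. The Gaussian is stated in
  \<open>z^2 / s\<close>, with constants independent of \<open>s\<close> and \<sigma>, since
  \<open>s\<close> will tend to 0.\<close>

lemma weighted_kernel_bound:
  assumes "0 < \<delta>" "0 < T"
  shows "\<exists>c C. 0 < c \<and> 0 < C \<and> (\<forall>s \<sigma> z. 0 < s \<longrightarrow> s \<le> T \<longrightarrow> s + \<delta> \<le> \<sigma> \<longrightarrow>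
      weighted_kernel x \<sigma> s z \<le> C / sqrt s * exp (- c * (z\<^sup>2 / s)))"
proof -
  \<comment> \<open>With this \<open>e\<close> at least half of \<delta> survives in
    \<open>\<delta> - e * s\<close> for \<open>s \<le> T\<close>, which gives the 8 in
    \<open>c\<close>.\<close>
  define e where "e = \<delta> / (2 * T)"
  define c where "c = \<delta> / (8 * (T + \<delta>))"
  define A where "A = (1 + 1 / e) * x\<^sup>2 / (4 * \<delta>)"
  have e: "0 < e" using assms by (simp add: e_def)
  have "0 < c" using assms by (simp add: c_def)
  have bound: "weighted_kernel x \<sigma> s z \<le> exp A / sqrt s * exp (- c * (z\<^sup>2 / s))"
    if s: "0 < s" "s \<le> T" "s + \<delta> \<le> \<sigma>" for s \<sigma> z
  proof -
    have "0 \<le> (e * z - x)\<^sup>2 / e" using e by simp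
    then have "2 * x * z \<le> e * z\<^sup>2 + x\<^sup>2 / e"
      using e by (simp add: field_simps power2_eq_square)
    then have sq: "(x + z)\<^sup>2 \<le> (1 + e) * z\<^sup>2 + (1 + 1 / e) * x\<^sup>2"
      by (simp add: algebra_simps power2_eq_square)
    have "(x + z)\<^sup>2 / (4 * \<sigma>) \<le> (x + z)\<^sup>2 / (4 * (s + \<delta>))"
      using s assms by (intro divide_left_mono) auto
    also have "\<dots> \<le> ((1 + e) * z\<^sup>2 + (1 + 1 / e) * x\<^sup>2) / (4 * (s + \<delta>))"
      using s assms sq by (intro divide_right_mono) auto
    also have "\<dots> = (1 + e) * z\<^sup>2 / (4 * (s + \<delta>)) + (1 + 1 / e) * x\<^sup>2 / (4 * (s + \<delta>))"
      by (simp add: add_divide_distrib)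
    also have "(1 + 1 / e) * x\<^sup>2 / (4 * (s + \<delta>)) \<le> A"
      unfolding A_def using s assms e by (intro divide_left_mono) auto
    finally have 1: "(x + z)\<^sup>2 / (4 * \<sigma>) \<le> (1 + e) * z\<^sup>2 / (4 * (s + \<delta>)) + A"
      by simp
    have "e * s \<le> \<delta> / 2"
      using s assms by (simp add: e_def field_simps)
    then have "\<delta> / 2 \<le> \<delta> - e * s" by simp
    have "c = (\<delta> / 2) / (4 * (T + \<delta>))"
      by (simp add: c_def)
    also have "\<dots> \<le> (\<delta> - e * s) / (4 * (s + \<delta>))"
      using s assms \<open>\<delta> / 2 \<le> \<delta> - e * s\<close> by (intro frac_le) auto
    also have "\<dots> = 1 / 4 - (1 + e) * s / (4 * (s + \<delta>))"
      using s assms by (simp add: field_simps)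
    finally have "c * (z\<^sup>2 / s) \<le> (1 / 4 - (1 + e) * s / (4 * (s + \<delta>))) * (z\<^sup>2 / s)"
      using s by (intro mult_right_mono) auto
    also have "\<dots> = z\<^sup>2 / (4 * s) - (1 + e) * z\<^sup>2 / (4 * (s + \<delta>))"
      using s assms by (simp add: field_simps)
    finally have 2: "- z\<^sup>2 / (4 * s) + (x + z)\<^sup>2 / (4 * \<sigma>) \<le> A + - c * (z\<^sup>2 / s)"
      using 1 by simp
    have "weighted_kernel x \<sigma> s z = exp (- z\<^sup>2 / (4 * s) + (x + z)\<^sup>2 / (4 * \<sigma>)) / sqrt (4 * pi * s)"
      by (simp only: exp_add) (simp add: weighted_kernel_def Theta_def omega_def exp_minus inverse_eq_divide)
    also have "\<dots> \<le> exp (A + - c * (z\<^sup>2 / s)) / sqrt s"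
    proof (rule frac_le)
      have "1 * s \<le> 4 * pi * s"
        using pi_gt3 s by (intro mult_right_mono) auto
      then show "sqrt s \<le> sqrt (4 * pi * s)" by simp
    qed (use 2 s in auto)
    also have "\<dots> = exp A / sqrt s * exp (- c * (z\<^sup>2 / s))"
      by (simp only: exp_add times_divide_eq_left)
    finally show ?thesis .
  qed
  show ?thesis
    using \<open>0 < c\<close> bound by (intro exI[of _ c] exI[of _ "exp A"]) auto
qed

text \<open>With \<open>\<Theta>\<close> the heat kernel and \<open>\<chi>\<close> the cutoff,
  \<open>(\<Theta> \<chi>)'' - \<Theta>'' \<chi> = 2 \<Theta>' \<chi>' + \<Theta> \<chi>'' = \<Theta> (\<chi>'' - z \<chi>' / s)\<close>.\<close>
definition error_flux :: "real \<Rightarrow> real \<Rightarrow> real \<Rightarrow> real" where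
  "error_flux a s z = cutoff2 a z - z * cutoff1 a z / s"

text \<open>The derivative in \<open>z\<close> of \<open>weighted_kernel\<close> times
  \<open>error_flux\<close>, with the kernel factored out; the last summand comes from the
  logarithmic derivative of the kernel.\<close>

definition error_flux' :: "real \<Rightarrow> real \<Rightarrow> real \<Rightarrow> real \<Rightarrow> real \<Rightarrow> real" where
  "error_flux' x \<sigma> a s z = cutoff3 a z - cutoff1 a z / s - z * cutoff2 a z / s
      + error_flux a s z * ((x + z) / (2 * \<sigma>) - z / (2 * s))"

lemma DERIV_error_flux:
  assumes "s \<noteq> 0" "\<sigma> \<noteq> 0"
  shows "((\<lambda>z. weighted_kernel x \<sigma> s z * error_flux a s z) has_real_derivative
      weighted_kernel x \<sigma> s z * error_flux' x \<sigma> a s z) (at z)"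
proof -
  have "(error_flux a s has_real_derivative
      cutoff3 a z - (1 * cutoff1 a z + cutoff2 a z * z) / s) (at z)"
    unfolding error_flux_def[abs_def]
    by (intro DERIV_diff DERIV_cdivide DERIV_mult DERIV_ident DERIV_cutoff1 DERIV_cutoff2)
  from DERIV_mult[OF DERIV_weighted_kernel[OF assms] this] show ?thesis
    by (rule DERIV_cong) (simp add: error_flux'_def algebra_simps add_divide_distrib)
qed

text \<open>Every factor \<open>1 / s\<close> meets two powers of \<open>z\<close> supplied by the
  cutoff, so only \<open>w = z\<^sup>2 / s\<close> occurs, and one \<open>\<bar>z\<bar>\<close> is
  left over to be set against the \<open>1 / sqrt s\<close> of the kernel. \<open>R\<^sup>2\<close>
  pays for the growth of \<open>(x + z) / (2 * \<sigma>)\<close>, \<open>X\<close> for its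
  dependence on \<open>x\<close> and \<delta>. The constant is 3872 = 3360 + 16 + 240 + 256.\<close>

lemma error_flux'_bound:
  fixes a z s R x \<sigma> \<delta> :: real
  assumes s: "0 < s" and \<sigma>: "\<delta> \<le> \<sigma>" "0 < \<delta>" and R: "1 \<le> R" "\<bar>z\<bar> \<le> R" and a: "0 \<le> a" "a * z ^ 4 \<le> 1"
  defines "X \<equiv> (\<bar>x\<bar> + 1) / (2 * \<delta>)"
  shows "\<bar>error_flux' x \<sigma> a s z\<bar> \<le> (3872 + 256 * X) * (a * R\<^sup>2) * \<bar>z\<bar> * (1 + z\<^sup>2 / s)\<^sup>2"
proof -
  define y where "y = \<bar>z\<bar>"
  define w where "w = z\<^sup>2 / s"
  have y: "0 \<le> y" "y \<le> R" and w: "0 \<le> w" "y\<^sup>2 / s = w" and X: "0 \<le> X"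
    using s R \<sigma> by (auto simp: y_def w_def X_def)
  note b = cutoff_bounds[OF a, folded y_def]
  have q: "\<bar>error_flux a s z\<bar> \<le> a * y\<^sup>2 * (240 + 16 * w)"
  proof -
    have "\<bar>error_flux a s z\<bar> \<le> \<bar>cutoff2 a z\<bar> + \<bar>z * cutoff1 a z / s\<bar>"
      unfolding error_flux_def by (rule abs_triangle_ineq4)
    also have "\<bar>z * cutoff1 a z / s\<bar> = y * \<bar>cutoff1 a z\<bar> / s"
      using s by (simp add: abs_mult y_def)
    also have "\<dots> \<le> y * (16 * a * y ^ 3) / s"
      using s y b by (intro divide_right_mono mult_left_mono) auto
    also have "\<dots> = a * y\<^sup>2 * (16 * (y\<^sup>2 / s))"
      by (simp add: eval_nat_numeral)
    finally show ?thesis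
      using b w by (simp add: algebra_simps)
  qed
  \<comment> \<open>One of the two factors \<open>y\<close> in the bound for
    \<open>error_flux\<close> is spent here, so that \<open>z / (2 * s)\<close> turns into
    \<open>w / 2\<close>.\<close>
  have k: "y * \<bar>(x + z) / (2 * \<sigma>) - z / (2 * s)\<bar> \<le> R\<^sup>2 * ((X + 1) * (1 + w))"
  proof -
    have "\<bar>x + z\<bar> / (2 * \<sigma>) \<le> ((\<bar>x\<bar> + 1) * R) / (2 * \<delta>)"
    proof (rule frac_le)
      have "\<bar>x\<bar> * 1 \<le> \<bar>x\<bar> * R" using R by (intro mult_left_mono) auto
      then show "\<bar>x + z\<bar> \<le> (\<bar>x\<bar> + 1) * R" using R by (simp add: algebra_simps)
    qed (use \<sigma> R in auto)
    then have "\<bar>x + z\<bar> / (2 * \<sigma>) \<le> X * R" by (simp add: X_def)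
    then have "\<bar>(x + z) / (2 * \<sigma>) - z / (2 * s)\<bar> \<le> X * R + y / (2 * s)"
      using abs_triangle_ineq4[of "(x + z) / (2 * \<sigma>)" "z / (2 * s)"] s \<sigma> by (simp add: y_def)
    then have "y * \<bar>(x + z) / (2 * \<sigma>) - z / (2 * s)\<bar> \<le> y * (X * R + y / (2 * s))"
      using y by (intro mult_left_mono)
    also have "\<dots> = X * (y * R) + w / 2"
      unfolding w(2)[symmetric] using s by (simp add: field_simps power2_eq_square)
    also have "\<dots> \<le> X * (R * R) + R\<^sup>2 * w"
    proof (rule add_mono)
      show "X * (y * R) \<le> X * (R * R)"
        using y R X by (intro mult_left_mono mult_right_mono) auto
      have "1 * w \<le> R\<^sup>2 * w"
        using w R by (intro mult_right_mono) (auto simp: one_le_power)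
      then show "w / 2 \<le> R\<^sup>2 * w" using w by simp
    qed
    also have "\<dots> = R\<^sup>2 * (X + w)" by (simp add: algebra_simps power2_eq_square)
    also have "\<dots> \<le> R\<^sup>2 * ((X + 1) * (1 + w))"
      using X w by (intro mult_left_mono) (auto simp: algebra_simps)
    finally show ?thesis .
  qed
  have "\<bar>cutoff3 a z\<bar> \<le> a * y * (R\<^sup>2 * (3360 * (1 + w)\<^sup>2))"
  proof -
    have "1 * 1 \<le> R\<^sup>2 * (1 + w)\<^sup>2"
      using R w by (intro mult_mono) (auto simp: one_le_power)
    then have "a * y * (3360 * 1) \<le> a * y * (3360 * (R\<^sup>2 * (1 + w)\<^sup>2))"
      using a y by (intro mult_left_mono) auto
    with b(5) show ?thesis by (simp add: algebra_simps)
  qed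
  moreover have triangle: "\<bar>p - q - r + t\<bar> \<le> P + Q + R' + T"
    if "\<bar>p\<bar> \<le> P" "\<bar>q\<bar> \<le> Q" "\<bar>r\<bar> \<le> R'" "\<bar>t\<bar> \<le> T" for p q r t P Q R' T :: real
    using that by linarith
  moreover have "\<bar>cutoff1 a z / s\<bar> \<le> a * y * (R\<^sup>2 * (16 * (1 + w)\<^sup>2))"
  proof -
    have "w \<le> (1 + w)\<^sup>2" using w by (simp add: power2_eq_square algebra_simps)
    then have le: "1 * w \<le> R\<^sup>2 * (1 + w)\<^sup>2"
      using R w by (intro mult_mono) (auto simp: one_le_power)
    have "\<bar>cutoff1 a z / s\<bar> \<le> (16 * a * y ^ 3) / s"
      using b s by (simp add: divide_right_mono)
    also have "\<dots> = a * y * (16 * w)"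
      unfolding w(2)[symmetric] by (simp add: eval_nat_numeral)
    also have "\<dots> \<le> a * y * (16 * (R\<^sup>2 * (1 + w)\<^sup>2))"
      using a y le by (intro mult_left_mono) auto
    finally show ?thesis by (simp add: algebra_simps)
  qed
  moreover have "\<bar>z * cutoff2 a z / s\<bar> \<le> a * y * (R\<^sup>2 * (240 * (1 + w)\<^sup>2))"
  proof -
    have "w \<le> (1 + w)\<^sup>2" using w by (simp add: power2_eq_square algebra_simps)
    then have le: "1 * w \<le> R\<^sup>2 * (1 + w)\<^sup>2"
      using R w by (intro mult_mono) (auto simp: one_le_power)
    have "\<bar>z * cutoff2 a z / s\<bar> = y * \<bar>cutoff2 a z\<bar> / s"
      using s by (simp add: abs_mult y_def)
    also have "\<dots> \<le> y * (240 * a * y\<^sup>2) / s"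
      using b s y by (intro divide_right_mono mult_left_mono) auto
    also have "\<dots> = a * y * (240 * w)"
      unfolding w(2)[symmetric] by (simp add: eval_nat_numeral)
    also have "\<dots> \<le> a * y * (240 * (R\<^sup>2 * (1 + w)\<^sup>2))"
      using a y le by (intro mult_left_mono) auto
    finally show ?thesis by (simp add: algebra_simps)
  qed
  moreover have "\<bar>error_flux a s z * ((x + z) / (2 * \<sigma>) - z / (2 * s))\<bar>
      \<le> a * y * (R\<^sup>2 * (256 * (X + 1) * (1 + w)\<^sup>2))"
  proof -
    have "\<bar>error_flux a s z * ((x + z) / (2 * \<sigma>) - z / (2 * s))\<bar>
        \<le> (a * y\<^sup>2 * (240 + 16 * w)) * \<bar>(x + z) / (2 * \<sigma>) - z / (2 * s)\<bar>"
      unfolding abs_mult using q by (intro mult_right_mono) auto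
    also have "\<dots> = (a * y * (240 + 16 * w)) * (y * \<bar>(x + z) / (2 * \<sigma>) - z / (2 * s)\<bar>)"
      by (simp add: power2_eq_square)
    also have "\<dots> \<le> (a * y * (256 * (1 + w))) * (R\<^sup>2 * ((X + 1) * (1 + w)))"
    proof (rule mult_mono)
      show "a * y * (240 + 16 * w) \<le> a * y * (256 * (1 + w))"
        using a y w by (intro mult_left_mono) auto
    qed (use a y w X k in auto)
    finally show ?thesis by (simp add: power2_eq_square algebra_simps)
  qed
  ultimately have "\<bar>error_flux' x \<sigma> a s z\<bar> \<le> a * y * (R\<^sup>2 * (3360 * (1 + w)\<^sup>2)) + a * y * (R\<^sup>2 * (16 * (1 + w)\<^sup>2))
      + a * y * (R\<^sup>2 * (240 * (1 + w)\<^sup>2)) + a * y * (R\<^sup>2 * (256 * (X + 1) * (1 + w)\<^sup>2))"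
    unfolding error_flux'_def by (intro triangle)
  also have "\<dots> = (3872 + 256 * X) * (a * R\<^sup>2) * y * (1 + w)\<^sup>2"
    by (simp add: algebra_simps)
  finally show ?thesis by (simp add: y_def w_def)
qed

text \<open>\<open>d (1 + w) \<le> 1 + c w / 3 \<le> exp (c w / 3)\<close>, cubed. In
  \<open>error_kernel_bound\<close> two of the three powers come from \<open>error_flux'\<close> and
  the third from \<open>\<bar>z\<bar> / sqrt s\<close>.\<close>

lemma power_exp_bound:
  fixes c :: real
  assumes "0 < c"
  obtains C where "0 < C" "\<And>w. 0 \<le> w \<Longrightarrow> (1 + w) ^ 3 * exp (- c * w) \<le> C"
proof
  define d where "d = min 1 (c / 3)"
  have d: "0 < d" "d \<le> 1" "d \<le> c / 3" using assms by (auto simp: d_def)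
  show "0 < 1 / d ^ 3" using d by simp
  fix w :: real assume "0 \<le> w"
  then have "d * (1 + w) \<le> 1 + c / 3 * w"
    using d mult_right_mono[of d "c / 3" w] by (simp add: algebra_simps)
  also have "\<dots> \<le> exp (c / 3 * w)" by (rule exp_ge_add_one_self)
  finally have "(d * (1 + w)) ^ 3 \<le> exp (c / 3 * w) ^ 3"
    using d \<open>0 \<le> w\<close> by (intro power_mono) auto
  also have "\<dots> = exp (c * w)"
    by (simp add: exp_of_nat_mult[symmetric])
  finally have "d ^ 3 * (1 + w) ^ 3 \<le> exp (c * w)"
    unfolding power_mult_distrib .
  then show "(1 + w) ^ 3 * exp (- c * w) \<le> 1 / d ^ 3"
    using d by (simp add: exp_minus field_simps)
qed

text \<open>The leftover \<open>\<bar>z\<bar>\<close> and the \<open>1 / sqrt s\<close> of the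
  kernel combine to \<open>sqrt w \<le> 1 + w\<close>, and the Gaussian absorbs the resulting cube,
  so nothing blows up as \<open>s\<close> tends to 0. For \<open>a = 1 / R^4\<close> the factor
  \<open>a R^2\<close> is \<open>1 / R^2\<close>, which beats the length \<open>2 R\<close> of the
  interval of integration.\<close>

lemma error_kernel_bound:
  fixes x \<delta> T :: real
  assumes "0 < \<delta>" "0 < T"
  shows "\<exists>K>0. \<forall>s \<sigma> z R. 0 < s \<longrightarrow> s \<le> T \<longrightarrow> s + \<delta> \<le> \<sigma> \<longrightarrow> 1 \<le> R \<longrightarrow> \<bar>z\<bar> \<le> R \<longrightarrow>
      \<bar>weighted_kernel x \<sigma> s z * error_flux' x \<sigma> (1 / R ^ 4) s z\<bar> \<le> K / R\<^sup>2"
proof -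
  obtain c C where c: "0 < c" "0 < C" and kernel: "\<And>s \<sigma> z. 0 < s \<Longrightarrow> s \<le> T \<Longrightarrow> s + \<delta> \<le> \<sigma> \<Longrightarrow>
      weighted_kernel x \<sigma> s z \<le> C / sqrt s * exp (- c * (z\<^sup>2 / s))"
    using weighted_kernel_bound[OF assms] by blast
  obtain D where D: "0 < D" "\<And>w. 0 \<le> w \<Longrightarrow> (1 + w) ^ 3 * exp (- c * w) \<le> D"
    using power_exp_bound[OF \<open>0 < c\<close>] by blast
  define X where "X = (\<bar>x\<bar> + 1) / (2 * \<delta>)"
  have X: "0 \<le> X" using assms by (simp add: X_def)
  show ?thesis
  proof (rule exI[of _ "C * (3872 + 256 * X) * D"], intro conjI allI impI)
    show "0 < C * (3872 + 256 * X) * D" using c D X by simp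
    fix s \<sigma> z R :: real
    assume *: "0 < s" "s \<le> T" "s + \<delta> \<le> \<sigma>" "1 \<le> R" "\<bar>z\<bar> \<le> R"
    define w where "w = z\<^sup>2 / s"
    have w: "0 \<le> w" using * by (simp add: w_def)
    have "z ^ 4 \<le> R ^ 4"
      using power_mono[OF *(5), of 4] by (simp add: power_even_abs)
    then have "1 / R ^ 4 * z ^ 4 \<le> 1" using * by (simp add: field_simps)
    then have flux: "\<bar>error_flux' x \<sigma> (1 / R ^ 4) s z\<bar> \<le> (3872 + 256 * X) * (1 / R ^ 4 * R\<^sup>2) * \<bar>z\<bar> * (1 + w)\<^sup>2"
      unfolding X_def w_def using * assms by (intro error_flux'_bound) auto
    have "\<bar>z\<bar> / sqrt s = sqrt w"
      using * by (simp add: w_def real_sqrt_divide)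
    also have "\<dots> \<le> 1 + w"
      using w by (intro real_le_lsqrt) (auto simp: power2_eq_square algebra_simps)
    finally have z: "\<bar>z\<bar> / sqrt s \<le> 1 + w" .
    have "\<bar>weighted_kernel x \<sigma> s z * error_flux' x \<sigma> (1 / R ^ 4) s z\<bar>
        \<le> (C / sqrt s * exp (- c * w)) * ((3872 + 256 * X) * (1 / R ^ 4 * R\<^sup>2) * \<bar>z\<bar> * (1 + w)\<^sup>2)"
      unfolding abs_mult w_def
      using kernel[of s \<sigma> z] flux[unfolded w_def] * weighted_kernel_pos[of s x \<sigma> z] c
      by (intro mult_mono) auto
    also have "\<dots> = C * (3872 + 256 * X) * (1 / R\<^sup>2) * ((\<bar>z\<bar> / sqrt s) * (1 + w)\<^sup>2 * exp (- c * w))"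
      using * by (simp add: field_simps eval_nat_numeral)
    also have "\<dots> \<le> C * (3872 + 256 * X) * (1 / R\<^sup>2) * D"
    proof (rule mult_left_mono)
      have "(\<bar>z\<bar> / sqrt s) * (1 + w)\<^sup>2 * exp (- c * w) \<le> (1 + w) * (1 + w)\<^sup>2 * exp (- c * w)"
        using z by (intro mult_right_mono) auto
      also have "\<dots> \<le> D" using D(2)[OF w] by (simp add: eval_nat_numeral)
      finally show "(\<bar>z\<bar> / sqrt s) * (1 + w)\<^sup>2 * exp (- c * w) \<le> D" .
    qed (use c X in auto)
    finally show "\<bar>weighted_kernel x \<sigma> s z * error_flux' x \<sigma> (1 / R ^ 4) s z\<bar>
        \<le> C * (3872 + 256 * X) * D / R\<^sup>2"
      by (simp add: mult.commute)
  qed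
qed

section \<open>The heat equation on a time slice\<close>

lemma cutoff_at_end:
  assumes "a * z ^ 4 = 1"
  shows "cutoff a z = 0" "cutoff1 a z = 0" "cutoff2 a z = 0"
  using assms by (auto simp: cutoff_def cutoff1_def cutoff2_def)

lemma error_flux_at_end: "a * z ^ 4 = 1 \<Longrightarrow> error_flux a s z = 0"
  by (simp add: error_flux_def cutoff_at_end)

lemma continuous_on_cutoff:
  "continuous_on S (cutoff a)" "continuous_on S (cutoff1 a)" "continuous_on S (cutoff2 a)" "continuous_on S (cutoff3 a)"
  unfolding cutoff_def[abs_def] cutoff1_def[abs_def] cutoff2_def[abs_def] cutoff3_def[abs_def]
  by (intro continuous_intros)+

lemma continuous_on_shift:
  fixes f :: "real \<Rightarrow> real"
  assumes "continuous_on UNIV f"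
  shows "continuous_on S (\<lambda>z. f (x + z))"
  by (rule continuous_on_compose2[OF assms]) (auto intro!: continuous_intros)

lemma continuous_on_Theta: "s \<noteq> 0 \<Longrightarrow> continuous_on S (Theta s)"
  using DERIV_Theta by (rule DERIV_imp_continuous_on)

lemma continuous_on_weighted_kernel: "s \<noteq> 0 \<Longrightarrow> \<sigma> \<noteq> 0 \<Longrightarrow> continuous_on S (weighted_kernel x \<sigma> s)"
  using DERIV_weighted_kernel by (rule DERIV_imp_continuous_on)

text \<open>Both the derivative of \<open>Theta\<close> in \<open>s\<close> and its second
  derivative in \<open>z\<close>: \<open>DERIV_Theta_time\<close> and
  \<open>DERIV_Theta_space2\<close> together are the heat equation for the kernel.\<close>

definition Theta_ss :: "real \<Rightarrow> real \<Rightarrow> real" where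
  "Theta_ss s z = (z\<^sup>2 / (4 * s\<^sup>2) - 1 / (2 * s)) * Theta s z"

lemma DERIV_Theta_time:
  assumes "0 < s"
  shows "((\<lambda>s. Theta s z) has_real_derivative Theta_ss s z) (at s)"
proof -
  have D: "((\<lambda>s. exp (- z\<^sup>2 / (4 * s)) / sqrt (4 * pi * s)) has_real_derivative
     (exp (- z\<^sup>2 / (4 * s)) * (z\<^sup>2 / (4 * s\<^sup>2)) * sqrt (4 * pi * s)
      - exp (- z\<^sup>2 / (4 * s)) * (4 * pi / (2 * sqrt (4 * pi * s)))) / (sqrt (4 * pi * s) * sqrt (4 * pi * s))) (at s)"
  proof (rule DERIV_divide)
    show "((\<lambda>s. exp (- z\<^sup>2 / (4 * s))) has_real_derivative exp (- z\<^sup>2 / (4 * s)) * (z\<^sup>2 / (4 * s\<^sup>2))) (at s)"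
      using assms by (auto intro!: derivative_eq_intros simp: power2_eq_square)
    show "((\<lambda>s. sqrt (4 * pi * s)) has_real_derivative 4 * pi / (2 * sqrt (4 * pi * s))) (at s)"
      using assms by (auto intro!: derivative_eq_intros simp: field_simps mult_less_0_iff)
  qed (use assms in auto)
  \<comment> \<open>The root is abstracted to a nonzero \<open>r\<close> with known square, which
    makes the identity a rational one.\<close>
  have quotient: "(e * b * r - e * (4 * pi / (2 * r))) / (r * r) = (b - 1 / (2 * s)) * (e / r)"
    if "r \<noteq> 0" "r * r = 4 * pi * s" for e b r
  proof -
    have "(e * b * r - e * (4 * pi / (2 * r))) / (r * r) = b * (e / r) - e / r * (4 * pi / (2 * (r * r)))"
      using that(1) by (simp add: field_simps)
    also have "4 * pi / (2 * (r * r)) = 1 / (2 * s)"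
      unfolding that(2) using assms by simp
    finally show ?thesis by (simp add: algebra_simps)
  qed
  show ?thesis
    unfolding Theta_def[abs_def] Theta_ss_def
    by (rule DERIV_cong[OF D quotient]) (use assms in auto)
qed

lemma DERIV_Theta_space2:
  assumes "s \<noteq> 0"
  shows "((\<lambda>z. - z / (2 * s) * Theta s z) has_real_derivative Theta_ss s z) (at z)"
proof -
  have "((\<lambda>z. - z / (2 * s)) has_real_derivative - 1 / (2 * s)) (at z)"
    using assms by (auto intro!: derivative_eq_intros)
  from DERIV_mult[OF this DERIV_Theta[OF assms]] show ?thesis
    by (rule DERIV_cong) (use assms in \<open>simp add: Theta_ss_def field_simps power2_eq_square\<close>)
qed

lemma DERIV_shift: "(\<And>y. (f has_real_derivative f' y) (at y)) \<Longrightarrow> ((\<lambda>z. f (x + z)) has_real_derivative f' (x + z)) (at z)"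
  using DERIV_at_within_shift[of f "f' (x + z)" x z UNIV] by simp

text \<open>The weak form of the heat equation on a time slice: moving all derivatives onto the localized
  kernel leaves only terms with a derivative on the cutoff, and these are paired with the primitive
  \<open>G\<close> of \<open>g \<omega>\<^sub>\<sigma>\<close>, the only quantity about which the norm gives information.\<close>
lemma flux_identity:
  fixes g g1 g2 G :: "real \<Rightarrow> real"
  assumes g: "\<And>y. (g has_real_derivative g1 y) (at y)" "\<And>y. (g1 has_real_derivative g2 y) (at y)"
    and g2: "continuous_on UNIV g2"
    and G: "\<And>y. (G has_real_derivative g y * omega \<sigma> y) (at y)"
    and "0 < s" "\<sigma> \<noteq> 0" "0 < R"
  defines "a \<equiv> 1 / R ^ 4"
  shows "((\<lambda>z. g2 (x + z) * (cutoff a z * Theta s z) - g (x + z) * (cutoff a z * Theta_ss s z)) has_integral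
      - integral {-R..R} (\<lambda>z. G (x + z) * (weighted_kernel x \<sigma> s z * error_flux' x \<sigma> a s z))) {-R..R}"
proof -
  have s: "s \<noteq> 0" using \<open>0 < s\<close> by simp
  have ends: "a * R ^ 4 = 1" "a * (- R) ^ 4 = 1"
    using \<open>0 < R\<close> by (auto simp: a_def)
  \<comment> \<open>For \<open>\<psi> = \<chi> \<Theta>\<close> the first two summands are
    \<open>g' \<psi> - g \<psi>'\<close>, with derivative \<open>g'' \<psi> - g \<psi>''\<close>.
    The part of \<open>g \<psi>''\<close> with derivatives on the cutoff equals
    \<open>g \<omega>\<^sub>\<sigma>\<close> times \<open>weighted_kernel\<close> times
    \<open>error_flux\<close>; the third summand, with \<open>G\<close> in place of
    \<open>g \<omega>\<^sub>\<sigma>\<close>, cancels it and leaves the term with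
    \<open>error_flux'\<close>. All three vanish at the end points.\<close>
  define H where "H z = g1 (x + z) * (cutoff a z * Theta s z)
      - g (x + z) * (cutoff1 a z * Theta s z + cutoff a z * (- z / (2 * s) * Theta s z))
      + G (x + z) * (weighted_kernel x \<sigma> s z * error_flux a s z)" for z
  have H: "(H has_real_derivative
      (g2 (x + z) * (cutoff a z * Theta s z) - g (x + z) * (cutoff a z * Theta_ss s z))
        + G (x + z) * (weighted_kernel x \<sigma> s z * error_flux' x \<sigma> a s z)) (at z)" for z
  proof -
    have kernel: "omega \<sigma> (x + z) * weighted_kernel x \<sigma> s z = Theta s z"
      using less_imp_neq[OF omega_pos[of \<sigma> "x + z"]] by (simp add: weighted_kernel_def)
    have "(H has_real_derivative
        (g2 (x + z) * (cutoff a z * Theta s z)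
          + (cutoff1 a z * Theta s z + (- z / (2 * s) * Theta s z) * cutoff a z) * g1 (x + z))
        - (g1 (x + z) * (cutoff1 a z * Theta s z + cutoff a z * (- z / (2 * s) * Theta s z))
          + ((cutoff2 a z * Theta s z + (- z / (2 * s) * Theta s z) * cutoff1 a z)
            + (cutoff1 a z * (- z / (2 * s) * Theta s z) + Theta_ss s z * cutoff a z)) * g (x + z))
        + ((g (x + z) * omega \<sigma> (x + z)) * (weighted_kernel x \<sigma> s z * error_flux a s z)
          + (weighted_kernel x \<sigma> s z * error_flux' x \<sigma> a s z) * G (x + z))) (at z)"
      unfolding H_def[abs_def]
      by (intro DERIV_add DERIV_diff DERIV_mult DERIV_shift[of g1 g2] DERIV_shift[of g g1] g
          DERIV_shift[of G "\<lambda>y. g y * omega \<sigma> y"] G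
          DERIV_cutoff DERIV_cutoff1 DERIV_Theta DERIV_Theta_space2 DERIV_error_flux s \<open>\<sigma> \<noteq> 0\<close>)
    then show ?thesis
    proof (rule DERIV_cong)
      have "(g (x + z) * omega \<sigma> (x + z)) * (weighted_kernel x \<sigma> s z * error_flux a s z)
          = g (x + z) * (omega \<sigma> (x + z) * weighted_kernel x \<sigma> s z) * error_flux a s z"
        by simp
      also have "\<dots> = g (x + z) * (Theta s z * (cutoff2 a z + 2 * (- z / (2 * s)) * cutoff1 a z))"
        unfolding kernel error_flux_def using s by simp
      finally show "(g2 (x + z) * (cutoff a z * Theta s z)
          + (cutoff1 a z * Theta s z + (- z / (2 * s) * Theta s z) * cutoff a z) * g1 (x + z))
        - (g1 (x + z) * (cutoff1 a z * Theta s z + cutoff a z * (- z / (2 * s) * Theta s z))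
          + ((cutoff2 a z * Theta s z + (- z / (2 * s) * Theta s z) * cutoff1 a z)
            + (cutoff1 a z * (- z / (2 * s) * Theta s z) + Theta_ss s z * cutoff a z)) * g (x + z))
        + ((g (x + z) * omega \<sigma> (x + z)) * (weighted_kernel x \<sigma> s z * error_flux a s z)
          + (weighted_kernel x \<sigma> s z * error_flux' x \<sigma> a s z) * G (x + z))
        = (g2 (x + z) * (cutoff a z * Theta s z) - g (x + z) * (cutoff a z * Theta_ss s z))
          + G (x + z) * (weighted_kernel x \<sigma> s z * error_flux' x \<sigma> a s z)"
        by (simp only:) (simp add: algebra_simps)
    qed
  qed
  have zero: "((\<lambda>z. (g2 (x + z) * (cutoff a z * Theta s z) - g (x + z) * (cutoff a z * Theta_ss s z))
        + G (x + z) * (weighted_kernel x \<sigma> s z * error_flux' x \<sigma> a s z)) has_integral 0) {-R..R}"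
    by (rule integral_deriv_cutoff[OF H])
      (use \<open>0 < R\<close> ends in \<open>auto simp: H_def cutoff_at_end error_flux_at_end\<close>)
  have int: "(\<lambda>z. G (x + z) * (weighted_kernel x \<sigma> s z * error_flux' x \<sigma> a s z)) integrable_on {-R..R}"
  proof (rule integrable_continuous_interval)
    have "continuous_on UNIV G" using G by (rule DERIV_imp_continuous_on)
    then show "continuous_on {-R..R} (\<lambda>z. G (x + z) * (weighted_kernel x \<sigma> s z * error_flux' x \<sigma> a s z))"
      unfolding error_flux'_def error_flux_def using s \<open>\<sigma> \<noteq> 0\<close>
      by (intro continuous_intros continuous_on_shift continuous_on_weighted_kernel continuous_on_cutoff) auto
  qed
  from has_integral_diff[OF zero integrable_integral[OF int]] show ?thesis
    by simp
qed

section \<open>Concentration of the heat kernel\<close>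

lemma Theta_has_integral:
  assumes "0 < s"
  shows "(Theta s has_integral 1) UNIV"
proof -
  \<comment> \<open>The heat kernel at time \<open>s\<close> is the normal density of variance
    \<open>2 * s\<close>.\<close>
  have "normal_density 0 (sqrt (2 * s)) = Theta s"
    using assms by (auto simp: normal_density_def Theta_def fun_eq_iff mult.commute)
  moreover have "0 < sqrt (2 * s)" using assms by simp
  ultimately show ?thesis
    using has_integral_integral_lborel[of "normal_density 0 (sqrt (2 * s))"]
      integrable_normal_density[of "sqrt (2 * s)" 0] integral_normal_density[of "sqrt (2 * s)" 0]
    by (simp del: integrable_normal_density integral_normal_density)
qed

lemma Theta_scaling: "0 < s \<Longrightarrow> sqrt s * Theta s (sqrt s * w) = Theta 1 w"
  by (simp add: Theta_def power_mult_distrib real_sqrt_mult)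

text \<open>The substitution \<open>z = sqrt s * w\<close> turns the kernel into the fixed
  \<open>Theta 1\<close>, and the bound of \<open>h\<close> on the compact rectangle gives an
  integrable majorant. \<open>h\<close> depends on \<open>s\<close> because the solution is
  evaluated at time \<open>T - s\<close> while the kernel concentrates.\<close>

lemma Theta_concentrates:
  fixes h :: "real \<Rightarrow> real \<Rightarrow> real"
  assumes cont: "continuous_on ({0..S} \<times> {-R..R}) (\<lambda>p. h (fst p) (snd p))" and "0 < R" "0 < S"
    and s: "\<And>n. 0 < s n" "\<And>n. s n \<le> S" "s \<longlonglongrightarrow> 0"
  shows "(\<lambda>n. integral {-R..R} (\<lambda>z. h (s n) z * Theta (s n) z)) \<longlonglongrightarrow> h 0 0"
proof -
  have "compact ((\<lambda>p. h (fst p) (snd p)) ` ({0..S} \<times> {-R..R}))"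
    using cont by (intro compact_continuous_image compact_Times) auto
  from compact_imp_bounded[OF this] obtain B where "\<forall>p\<in>{0..S} \<times> {-R..R}. \<bar>h (fst p) (snd p)\<bar> \<le> B"
    unfolding bounded_iff by auto
  then have B: "\<bar>h s z\<bar> \<le> B" if "0 \<le> s" "s \<le> S" "\<bar>z\<bar> \<le> R" for s z
    using that by (auto simp: abs_le_iff)
  \<comment> \<open>The interval in the variable \<open>w\<close>; it exhausts the line as
    \<open>s n\<close> tends to 0.\<close>
  define J where "J n = (\<lambda>x. x / sqrt (s n)) ` {-R..R}" for n
  have J: "w \<in> J n \<longleftrightarrow> \<bar>sqrt (s n) * w\<bar> \<le> R" for w n
  proof -
    have "w = x / sqrt (s n) \<longleftrightarrow> x = sqrt (s n) * w" for x
      using s(1)[of n] by (auto simp: field_simps)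
    then show ?thesis
      unfolding J_def image_iff by (auto simp: abs_le_iff)
  qed
  define k where "k n w = (if w \<in> J n then h (s n) (sqrt (s n) * w) * Theta 1 w else 0)" for n w
  have k: "(k n has_integral integral {-R..R} (\<lambda>z. h (s n) z * Theta (s n) z)) UNIV" for n
  proof -
    have r: "0 < sqrt (s n)" using s(1)[of n] by simp
    have "continuous_on {-R..R} (\<lambda>z. h (s n) z)"
      using continuous_on_compose2[OF cont, of "{-R..R}" "\<lambda>z. (s n, z)"] s(1,2)[of n]
      by (auto simp: continuous_on_Pair less_imp_le image_subset_iff)
    then have "(\<lambda>z. h (s n) z * Theta (s n) z) integrable_on {-R..R}"
      using s(1)[of n] by (intro integrable_continuous_interval continuous_on_mult continuous_on_Theta) auto
    from has_integral_stretch_real[OF integrable_integral[OF this], of "sqrt (s n)"] r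
    have "((\<lambda>w. h (s n) (sqrt (s n) * w) * Theta (s n) (sqrt (s n) * w)) has_integral
        1 / sqrt (s n) * integral {-R..R} (\<lambda>z. h (s n) z * Theta (s n) z)) (J n)"
      by (simp add: J_def)
    from has_integral_mult_right[OF this, of "sqrt (s n)"] r
    have "((\<lambda>w. sqrt (s n) * (h (s n) (sqrt (s n) * w) * Theta (s n) (sqrt (s n) * w))) has_integral
        integral {-R..R} (\<lambda>z. h (s n) z * Theta (s n) z)) (J n)"
      by simp
    moreover have "sqrt (s n) * (h (s n) (sqrt (s n) * w) * Theta (s n) (sqrt (s n) * w))
        = h (s n) (sqrt (s n) * w) * Theta 1 w" for w
      using Theta_scaling[OF s(1)[of n], of w] by (metis mult.left_commute)
    ultimately show ?thesis
      unfolding k_def[abs_def] by (subst has_integral_restrict_UNIV) simp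
  qed
  have "(\<lambda>n. integral UNIV (k n)) \<longlonglongrightarrow> integral UNIV (\<lambda>w. h 0 0 * Theta 1 w)"
  proof (rule dominated_convergence(2))
    show "k n integrable_on UNIV" for n using k by blast
    show "(\<lambda>w. B * Theta 1 w) integrable_on UNIV"
      using has_integral_mult_right[OF Theta_has_integral[of 1], of B] by auto
    have "0 \<le> B" using B[of 0 0] \<open>0 < R\<close> \<open>0 < S\<close> by auto
    then show "norm (k n w) \<le> B * Theta 1 w" for n w
      using B[of "s n" "sqrt (s n) * w"] s(1,2)[of n] J[of w n] Theta_pos[of 1 w]
      by (auto simp: k_def abs_mult intro!: mult_right_mono)
    fix w :: real
    have sw: "(\<lambda>n. sqrt (s n) * w) \<longlonglongrightarrow> 0"
      using tendsto_mult[OF tendsto_real_sqrt[OF s(3)] tendsto_const[of w]] by simp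
    have ev: "\<forall>\<^sub>F n in sequentially. w \<in> J n"
      using order_tendstoD(2)[OF tendsto_rabs[OF sw], of R] \<open>0 < R\<close>
      by (auto simp: J elim: eventually_mono)
    have "(\<lambda>n. h (fst (s n, sqrt (s n) * w)) (snd (s n, sqrt (s n) * w))) \<longlonglongrightarrow> h (fst (0::real, 0::real)) (snd (0::real, 0::real))"
    proof (rule continuous_on_tendsto_compose[OF cont])
      show "(\<lambda>n. (s n, sqrt (s n) * w)) \<longlonglongrightarrow> (0, 0)"
        by (intro tendsto_Pair s sw)
      show "\<forall>\<^sub>F n in sequentially. (s n, sqrt (s n) * w) \<in> {0..S} \<times> {-R..R}"
        using ev s(1,2) by (auto elim!: eventually_mono simp: J abs_le_iff less_imp_le)
    qed (use \<open>0 < R\<close> \<open>0 < S\<close> in auto)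
    then have "(\<lambda>n. h (s n) (sqrt (s n) * w) * Theta 1 w) \<longlonglongrightarrow> h 0 0 * Theta 1 w"
      by (intro tendsto_intros) simp
    then show "(\<lambda>n. k n w) \<longlonglongrightarrow> h 0 0 * Theta 1 w"
      by (rule Lim_transform_eventually) (use ev in \<open>auto elim!: eventually_mono simp: k_def\<close>)
  qed
  moreover have "integral UNIV (\<lambda>w. h 0 0 * Theta 1 w) = h 0 0"
    using integral_unique[OF Theta_has_integral[of 1]] by simp
  moreover have "integral UNIV (k n) = integral {-R..R} (\<lambda>z. h (s n) z * Theta (s n) z)" for n
    using k by (rule integral_unique)
  ultimately show ?thesis by (simp only:)
qed

section \<open>The localized kernel against primitives\<close>

lemma continuous_on_Theta_pair:
  assumes "continuous_on S f" "continuous_on S g" "\<And>p. p \<in> S \<Longrightarrow> 0 < f p"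
  shows "continuous_on S (\<lambda>p. Theta (f p) (g p))" "continuous_on S (\<lambda>p. Theta_ss (f p) (g p))"
proof -
  show "continuous_on S (\<lambda>p. Theta (f p) (g p))"
    unfolding Theta_def using assms by (intro continuous_intros) fastforce+
  then show "continuous_on S (\<lambda>p. Theta_ss (f p) (g p))"
    unfolding Theta_ss_def using assms by (intro continuous_intros) fastforce+
qed

lemma continuous_on_cutoff_pair:
  assumes "continuous_on S g"
  shows "continuous_on S (\<lambda>p. cutoff a (g p))" "continuous_on S (\<lambda>p. cutoff1 a (g p))"
  unfolding cutoff_def cutoff1_def by (intro continuous_intros assms)+

text \<open>The derivative in \<open>z\<close> of
  \<open>cutoff a z * weighted_kernel x \<sigma> s z\<close>, against which a primitive is
  integrated once the pairing has been integrated by parts.\<close>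

definition localized_kernel' :: "real \<Rightarrow> real \<Rightarrow> real \<Rightarrow> real \<Rightarrow> real \<Rightarrow> real" where
  "localized_kernel' x \<sigma> a s z = cutoff1 a z * weighted_kernel x \<sigma> s z
      + cutoff a z * (weighted_kernel x \<sigma> s z * ((x + z) / (2 * \<sigma>) - z / (2 * s)))"

lemma continuous_on_localized_kernel'_pair:
  assumes f: "continuous_on S f" and g: "continuous_on S g" and pos: "\<And>p. p \<in> S \<Longrightarrow> 0 < f p" and "\<sigma> \<noteq> 0"
  shows "continuous_on S (\<lambda>p. localized_kernel' x \<sigma> a (f p) (g p))"
proof -
  have omega: "continuous_on S (\<lambda>p. omega \<sigma> (x + g p))"
    using \<open>\<sigma> \<noteq> 0\<close> unfolding omega_def by (intro continuous_intros g) auto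
  have wk: "continuous_on S (\<lambda>p. weighted_kernel x \<sigma> (f p) (g p))"
    unfolding weighted_kernel_def
    by (intro continuous_on_divide continuous_on_Theta_pair f g pos omega)
      (use omega_pos in \<open>auto simp: less_imp_neq[OF omega_pos, symmetric]\<close>)
  have "continuous_on S (\<lambda>p. (x + g p) / (2 * \<sigma>) - g p / (2 * f p))"
    using pos \<open>\<sigma> \<noteq> 0\<close> by (intro continuous_intros f g) fastforce+
  then show ?thesis
    unfolding localized_kernel'_def
    by (intro continuous_on_add continuous_on_mult continuous_on_cutoff_pair g wk)
qed

lemma continuous_on_localized_kernel':
  "0 < s \<Longrightarrow> \<sigma> \<noteq> 0 \<Longrightarrow> continuous_on S (localized_kernel' x \<sigma> a s)"
  by (rule continuous_on_localized_kernel'_pair) (auto intro: continuous_intros)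

lemma localized_by_parts:
  assumes P: "\<And>y. (P has_real_derivative p y) (at y)" and p: "continuous_on UNIV p"
    and "0 < s" "\<sigma> \<noteq> 0" "0 < R"
  defines "a \<equiv> 1 / R ^ 4"
  shows "integral {-R..R} (\<lambda>z. p (x + z) * (cutoff a z * weighted_kernel x \<sigma> s z))
      = - integral {-R..R} (\<lambda>z. P (x + z) * localized_kernel' x \<sigma> a s z)"
proof -
  have s: "s \<noteq> 0" using \<open>0 < s\<close> by simp
  have ends: "a * R ^ 4 = 1" "a * (- R) ^ 4 = 1"
    using \<open>0 < R\<close> by (auto simp: a_def)
  have contP: "continuous_on UNIV P" using P by (rule DERIV_imp_continuous_on)
  have "((\<lambda>z. P (x + z) * (cutoff a z * weighted_kernel x \<sigma> s z)) has_real_derivative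
      p (x + z) * (cutoff a z * weighted_kernel x \<sigma> s z) + localized_kernel' x \<sigma> a s z * P (x + z)) (at z)" for z
  proof -
    have "((\<lambda>z. cutoff a z * weighted_kernel x \<sigma> s z) has_real_derivative localized_kernel' x \<sigma> a s z) (at z)"
      using DERIV_mult[OF DERIV_cutoff DERIV_weighted_kernel[OF s \<open>\<sigma> \<noteq> 0\<close>], of a x z]
      by (rule DERIV_cong) (simp add: localized_kernel'_def algebra_simps)
    from DERIV_mult[OF DERIV_shift[of P p, OF P] this] show ?thesis .
  qed
  then have "((\<lambda>z. p (x + z) * (cutoff a z * weighted_kernel x \<sigma> s z)
      + localized_kernel' x \<sigma> a s z * P (x + z)) has_integral 0) {-R..R}"
    by (rule integral_deriv_cutoff) (use \<open>0 < R\<close> ends in \<open>auto simp: cutoff_at_end\<close>)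
  moreover have "(\<lambda>z. p (x + z) * (cutoff a z * weighted_kernel x \<sigma> s z)) integrable_on {-R..R}"
    by (intro integrable_continuous_interval continuous_on_mult continuous_on_shift p continuous_on_cutoff
        continuous_on_weighted_kernel s \<open>\<sigma> \<noteq> 0\<close>)
  moreover have "(\<lambda>z. localized_kernel' x \<sigma> a s z * P (x + z)) integrable_on {-R..R}"
    by (intro integrable_continuous_interval continuous_on_mult continuous_on_shift contP
        continuous_on_localized_kernel' \<open>0 < s\<close> \<open>\<sigma> \<noteq> 0\<close>)
  ultimately show ?thesis
    using integral_add[of "\<lambda>z. p (x + z) * (cutoff a z * weighted_kernel x \<sigma> s z)" "{-R..R}"
        "\<lambda>z. localized_kernel' x \<sigma> a s z * P (x + z)"]
    by (simp add: integral_unique mult.commute[of "localized_kernel' x \<sigma> a s _"])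
qed

text \<open>For \<open>f\<close> with primitive \<open>F\<close> in the weight \<tau>, both sides
  are minus the localized pairing of \<open>f\<close> with the heat kernel, which involves no
  weight. Formally, the kernel for \<tau> is \<open>exp (- c * (x + z)\<^sup>2)\<close> times the
  kernel for \<sigma>, and one integration by parts removes \<open>Q\<close>. This joins the
  convergence known for \<sigma> to the convolution, which is defined with \<tau>.\<close>

lemma localized_change_weight:
  assumes F: "continuous_on UNIV F" and "0 < \<sigma>" "\<sigma> < \<tau>" "0 < s" "0 < R"
  defines "c \<equiv> 1 / (4 * \<sigma>) - 1 / (4 * \<tau>)" and "a \<equiv> 1 / R ^ 4"
  assumes Q: "\<And>y. (Q has_real_derivative F y * (- 2 * c * y * exp (- c * y\<^sup>2))) (at y)"
  shows "integral {-R..R} (\<lambda>z. (F (x + z) * exp (- c * (x + z)\<^sup>2) - Q (x + z)) * localized_kernel' x \<sigma> a s z)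
      = integral {-R..R} (\<lambda>z. F (x + z) * localized_kernel' x \<tau> a s z)"
proof -
  let ?r = "\<lambda>y. exp (- c * y\<^sup>2)" and ?r' = "\<lambda>y. - 2 * c * y * exp (- c * y\<^sup>2)"
  let ?k = "localized_kernel' x \<sigma> a s" and ?w = "\<lambda>z. cutoff a z * weighted_kernel x \<sigma> s z"
  have contQ: "continuous_on UNIV Q" using Q by (rule DERIV_imp_continuous_on)
  have contr: "continuous_on UNIV ?r" "continuous_on UNIV (\<lambda>y. F y * ?r' y)" "continuous_on UNIV (\<lambda>y. F y * ?r y)"
    by (intro continuous_intros F)+
  have int: "(\<lambda>z. Q (x + z) * ?k z) integrable_on {-R..R}"
      "(\<lambda>z. (F (x + z) * ?r (x + z)) * ?k z) integrable_on {-R..R}"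
      "(\<lambda>z. (F (x + z) * ?r' (x + z)) * ?w z) integrable_on {-R..R}"
    using assms by (intro integrable_continuous_interval continuous_on_mult[OF continuous_on_shift[OF contQ]]
        continuous_on_mult[OF continuous_on_shift[OF contr(2)]] continuous_on_mult[OF continuous_on_shift[OF contr(3)]]
        continuous_on_mult[OF continuous_on_cutoff(1)]
        continuous_on_localized_kernel' continuous_on_weighted_kernel; simp)+
  have "integral {-R..R} (\<lambda>z. (F (x + z) * ?r (x + z) - Q (x + z)) * ?k z)
      = integral {-R..R} (\<lambda>z. (F (x + z) * ?r (x + z)) * ?k z) - integral {-R..R} (\<lambda>z. Q (x + z) * ?k z)"
    unfolding left_diff_distrib by (rule integral_diff[OF int(2,1)])
  also have "\<dots> = integral {-R..R} (\<lambda>z. (F (x + z) * ?r (x + z)) * ?k z)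
      + integral {-R..R} (\<lambda>z. (F (x + z) * ?r' (x + z)) * ?w z)"
    using localized_by_parts[OF Q contr(2) \<open>0 < s\<close>, of \<sigma> R x] assms by (simp add: a_def)
  also have "\<dots> = integral {-R..R} (\<lambda>z. (F (x + z) * ?r (x + z)) * ?k z + (F (x + z) * ?r' (x + z)) * ?w z)"
    by (rule integral_add[OF int(2,3), symmetric])
  also have "\<dots> = integral {-R..R} (\<lambda>z. F (x + z) * localized_kernel' x \<tau> a s z)"
  proof (rule integral_cong)
    fix z
    have om: "omega \<sigma> (x + z) = omega \<tau> (x + z) * ?r (x + z)"
      using omega_change_weight[of \<sigma> \<tau> "x + z"] assms by (simp add: c_def)
    have w: "weighted_kernel x \<tau> s z = ?r (x + z) * weighted_kernel x \<sigma> s z"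
      unfolding weighted_kernel_def om by simp
    \<comment> \<open>The logarithmic derivatives of the two kernels differ by that of
      \<open>?r\<close>, which is \<open>- 2 * c * (x + z)\<close>.\<close>
    have c: "(x + z) / (2 * \<tau>) = (x + z) / (2 * \<sigma>) - 2 * c * (x + z)"
      using assms by (simp add: c_def field_simps)
    show "(F (x + z) * ?r (x + z)) * ?k z + (F (x + z) * ?r' (x + z)) * ?w z
        = F (x + z) * localized_kernel' x \<tau> a s z"
      unfolding localized_kernel'_def w c by (simp only: algebra_simps)
  qed
  finally show ?thesis .
qed

section \<open>The localized pairing as a function of time\<close>

text \<open>By the Leibniz rule, the heat equation and \<open>flux_identity\<close>, the derivative
  of \<open>v\<close> is minus an integral of \<open>G\<close> against the differentiated error
  term, at most \<open>2 * R * N * (K / R\<^sup>2)\<close> in absolute value; the mean value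
  inequality over a time of length at most \<open>T\<close> finishes. The weight \<sigma> and the
  primitive \<open>G\<close> are chosen anew for each \<open>t\<close>, which is legitimate because
  \<open>v\<close> mentions neither.\<close>

lemma localized_increment_bound:
  fixes u ux uxx ut :: "real \<Rightarrow> real \<Rightarrow> real" and x T \<tau> \<delta> N K R :: real
  assumes T: "0 < T" "T < \<tau>" and "0 < \<delta>"
    and ux: "\<And>x t. 0 < t \<Longrightarrow> t < \<tau> \<Longrightarrow> ((\<lambda>y. u y t) has_real_derivative ux x t) (at x)"
    and uxx: "\<And>x t. 0 < t \<Longrightarrow> t < \<tau> \<Longrightarrow> ((\<lambda>y. ux y t) has_real_derivative uxx x t) (at x)"
    and ut: "\<And>x t. 0 < t \<Longrightarrow> t < \<tau> \<Longrightarrow> ((\<lambda>s. u x s) has_real_derivative ut x t) (at t)"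
    and cont: "continuous_on (UNIV \<times> {0<..<\<tau>}) (\<lambda>p. u (fst p) (snd p))"
              "continuous_on (UNIV \<times> {0<..<\<tau>}) (\<lambda>p. ut (fst p) (snd p))"
    and heat: "\<And>x t. 0 < t \<Longrightarrow> t < \<tau> \<Longrightarrow> ut x t = uxx x t"
    and prim: "\<And>t. 0 < t \<Longrightarrow> t < T \<Longrightarrow> \<exists>\<sigma> G. T - t + \<delta> \<le> \<sigma> \<and>
        (\<forall>y. (G has_real_derivative u y t * omega \<sigma> y) (at y)) \<and> (\<forall>y. \<bar>G y\<bar> \<le> N)"
    and K: "\<And>s \<sigma> z. \<lbrakk>0 < s; s \<le> T; s + \<delta> \<le> \<sigma>; \<bar>z\<bar> \<le> R\<rbrakk> \<Longrightarrow>
      \<bar>weighted_kernel x \<sigma> s z * error_flux' x \<sigma> (1 / R ^ 4) s z\<bar> \<le> K / R\<^sup>2"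
    and "1 \<le> R"
  defines "v t \<equiv> integral {-R..R} (\<lambda>z. u (x + z) t * (cutoff (1 / R ^ 4) z * Theta (T - t) z))"
  assumes t: "0 < t1" "t1 < T" "0 < t2" "t2 < T"
  shows "\<bar>v t2 - v t1\<bar> \<le> 2 * N * K * T / R"
proof -
  define a where "a = 1 / R ^ 4"
  define f' where "f' t z = ut (x + z) t * (cutoff a z * Theta (T - t) z)
      - u (x + z) t * (cutoff a z * Theta_ss (T - t) z)" for t z
  have cont_u: "continuous_on ({0<..<T} \<times> {-R..R}) (\<lambda>p. u (x + snd p) (fst p))"
      "continuous_on ({0<..<T} \<times> {-R..R}) (\<lambda>p. ut (x + snd p) (fst p))"
    using T by (auto intro!: continuous_on_compose2[OF cont(1), of _ "\<lambda>p. (x + snd p, fst p)", simplified]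
        continuous_on_compose2[OF cont(2), of _ "\<lambda>p. (x + snd p, fst p)", simplified] continuous_intros)
  have cont_slice: "continuous_on S (\<lambda>z. u (x + z) t)" if "0 < t" "t < T" for t S
    using T that by (intro continuous_on_shift DERIV_imp_continuous_on[OF ux]) auto
  have deriv_v: "(v has_real_derivative integral {-R..R} (f' t)) (at t within {0<..<T})" if "t \<in> {0<..<T}" for t
  proof -
    have "((\<lambda>t. integral (cbox (-R) R) (\<lambda>z. u (x + z) t * (cutoff a z * Theta (T - t) z)))
        has_field_derivative integral (cbox (-R) R) (f' t)) (at t within {0<..<T})"
    proof (rule leibniz_rule_field_derivative)
      fix t z assume t: "t \<in> {0<..<T}"
      have Theta': "((\<lambda>t. Theta (T - t) z) has_real_derivative - Theta_ss (T - t) z) (at t)"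
        using DERIV_chain2[OF DERIV_Theta_time[of "T - t" z] DERIV_diff[OF DERIV_const DERIV_ident, of T t]] t
        by simp
      have "((\<lambda>t. u (x + z) t * (cutoff a z * Theta (T - t) z)) has_real_derivative f' t z) (at t)"
        by (rule DERIV_cong[OF DERIV_mult[OF ut[of t "x + z"] DERIV_cmult[OF Theta']]])
          (use t T in \<open>auto simp: f'_def algebra_simps\<close>)
      then show "((\<lambda>t. u (x + z) t * (cutoff a z * Theta (T - t) z)) has_field_derivative f' t z) (at t within {0<..<T})"
        by (rule has_field_derivative_at_within)
    next
      fix t assume "t \<in> {0<..<T}"
      then show "(\<lambda>z. u (x + z) t * (cutoff a z * Theta (T - t) z)) integrable_on cbox (-R) R"
        by (intro integrable_continuous continuous_on_mult cont_slice continuous_on_cutoff continuous_on_Theta) auto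
    next
      have "continuous_on ({0<..<T} \<times> {-R..R}) (\<lambda>p. f' (fst p) (snd p))"
        unfolding f'_def
        by (intro continuous_on_diff continuous_on_mult cont_u continuous_on_cutoff_pair continuous_on_Theta_pair)
          (auto intro!: continuous_intros)
      then show "continuous_on ({0<..<T} \<times> cbox (-R) R) (\<lambda>(t, z). f' t z)"
        by (simp add: case_prod_unfold)
    qed (use that in auto)
    then show ?thesis
      by (simp add: v_def[abs_def] a_def)
  qed
  have N: "0 \<le> N"
  proof -
    from T have "0 < T / 2" "T / 2 < T" by auto
    from prim[OF this] obtain G where "\<forall>y::real. \<bar>G y :: real\<bar> \<le> N" by blast
    then have "\<bar>G 0\<bar> \<le> N" by blast
    then show ?thesis by linarith
  qed
  have bound: "norm (integral {-R..R} (f' t)) \<le> 2 * N * K / R" if "t \<in> {0<..<T}" for t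
  proof -
    from that have t: "0 < t" "t < T" by auto
    obtain \<sigma> G where \<sigma>: "T - t + \<delta> \<le> \<sigma>" and G: "\<And>y. (G has_real_derivative u y t * omega \<sigma> y) (at y)"
      and GN: "\<And>y. \<bar>G y\<bar> \<le> N"
      using prim[OF t] by blast
    have "\<sigma> \<noteq> 0" "0 < T - t" using \<sigma> t \<open>0 < \<delta>\<close> by auto
    have cont_uxx: "continuous_on UNIV (\<lambda>y. uxx y t)"
    proof -
      have "continuous_on UNIV (\<lambda>y. ut y t)"
        by (rule continuous_on_compose2[OF cont(2), of _ "\<lambda>y. (y, t)", simplified])
          (use t T in \<open>auto intro!: continuous_intros\<close>)
      then show ?thesis using heat[OF t(1)] t T by simp
    qed
    have "((\<lambda>z. uxx (x + z) t * (cutoff a z * Theta (T - t) z) - u (x + z) t * (cutoff a z * Theta_ss (T - t) z))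
        has_integral - integral {-R..R} (\<lambda>z. G (x + z) * (weighted_kernel x \<sigma> (T - t) z * error_flux' x \<sigma> a (T - t) z))) {-R..R}"
      unfolding a_def
    proof (rule flux_identity[OF _ _ cont_uxx G \<open>0 < T - t\<close> \<open>\<sigma> \<noteq> 0\<close>])
      show "((\<lambda>y. u y t) has_real_derivative ux y t) (at y)" "((\<lambda>y. ux y t) has_real_derivative uxx y t) (at y)" for y
        using t T by (intro ux uxx; simp)+
    qed (use \<open>1 \<le> R\<close> in simp)
    then have eq: "integral {-R..R} (f' t)
        = - integral {-R..R} (\<lambda>z. G (x + z) * (weighted_kernel x \<sigma> (T - t) z * error_flux' x \<sigma> a (T - t) z))"
      using heat[of t] t T by (simp add: f'_def[abs_def] integral_unique)
    have "norm (integral {-R..R} (\<lambda>z. G (x + z) * (weighted_kernel x \<sigma> (T - t) z * error_flux' x \<sigma> a (T - t) z)))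
        \<le> (N * (K / R\<^sup>2)) * (R - - R)"
    proof (rule integral_bound)
      have "continuous_on UNIV G" using G by (rule DERIV_imp_continuous_on)
      then show "continuous_on {-R..R} (\<lambda>z. G (x + z) * (weighted_kernel x \<sigma> (T - t) z * error_flux' x \<sigma> a (T - t) z))"
        unfolding error_flux'_def error_flux_def using \<open>0 < T - t\<close> \<open>\<sigma> \<noteq> 0\<close>
        by (intro continuous_intros continuous_on_shift continuous_on_weighted_kernel continuous_on_cutoff) auto
      fix z assume "z \<in> {-R..R}"
      then have "\<bar>z\<bar> \<le> R" by auto
      then have "\<bar>weighted_kernel x \<sigma> (T - t) z * error_flux' x \<sigma> a (T - t) z\<bar> \<le> K / R\<^sup>2"
        unfolding a_def using \<sigma> t \<open>0 < T - t\<close> by (intro K) auto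
      then show "norm (G (x + z) * (weighted_kernel x \<sigma> (T - t) z * error_flux' x \<sigma> a (T - t) z)) \<le> N * (K / R\<^sup>2)"
        unfolding real_norm_def abs_mult[of "G (x + z)"] using GN N by (intro mult_mono) auto
    qed (use \<open>1 \<le> R\<close> in auto)
    also have "\<dots> = 2 * N * K / R"
      using \<open>1 \<le> R\<close> by (simp add: field_simps power2_eq_square)
    finally show ?thesis
      unfolding eq by simp
  qed
  have "norm (v t2 - v t1) \<le> 2 * N * K / R * norm (t2 - t1)"
    by (rule field_differentiable_bound[where S = "{0<..<T}" and f' = "\<lambda>t. integral {-R..R} (f' t)"])
      (use deriv_v bound t in auto)
  also have "\<dots> \<le> 2 * N * K / R * T"
  proof (rule mult_left_mono)
    show "norm (t2 - t1) \<le> T" using t by auto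
    \<comment> \<open>The sign of the constant is read off from the norm bound at one sample
      time.\<close>
    from T have "T / 2 \<in> {0<..<T}" by auto
    from bound[OF this] show "0 \<le> 2 * N * K / R"
      by (rule order_trans[OF norm_ge_zero])
  qed
  finally show ?thesis by simp
qed

section \<open>Limits at the two ends of the time interval\<close>

text \<open>This is \<open>Theta_concentrates\<close> for
  \<open>h s z = u (x + z) (T - s) * cutoff a z\<close>, with \<open>cutoff a 0 = 1\<close>; the
  restriction \<open>s n \<le> T / 2\<close> keeps the times in a compact subinterval of (0,
  \<tau>).\<close>

lemma localized_terminal_limit:
  fixes u :: "real \<Rightarrow> real \<Rightarrow> real"
  assumes T: "0 < T" "T < \<tau>"
    and cont: "continuous_on (UNIV \<times> {0<..<\<tau>}) (\<lambda>p. u (fst p) (snd p))"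
    and "0 < R" and s: "\<And>n. 0 < s n" "\<And>n. s n \<le> T / 2" "s \<longlonglongrightarrow> 0"
  shows "(\<lambda>n. integral {-R..R} (\<lambda>z. u (x + z) (T - s n) * (cutoff a z * Theta (s n) z))) \<longlonglongrightarrow> u x T"
proof -
  have "(\<lambda>n. integral {-R..R} (\<lambda>z. (u (x + z) (T - s n) * cutoff a z) * Theta (s n) z))
      \<longlonglongrightarrow> u (x + 0) (T - 0) * cutoff a 0"
  proof (rule Theta_concentrates[where S = "T / 2"])
    have "continuous_on ({0..T / 2} \<times> {-R..R}) (\<lambda>p. u (x + snd p) (T - fst p))"
      by (rule continuous_on_compose2[OF cont, of _ "\<lambda>p. (x + snd p, T - fst p)", simplified])
        (use T in \<open>auto intro!: continuous_intros\<close>)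
    then show "continuous_on ({0..T / 2} \<times> {-R..R}) (\<lambda>p. u (x + snd p) (T - fst p) * cutoff a (snd p))"
      by (intro continuous_on_mult continuous_on_cutoff_pair) (auto intro!: continuous_intros)
  qed (use assms in auto)
  then show ?thesis
    by (simp add: cutoff_def mult.assoc)
qed

text \<open>The functions \<open>g n\<close> need not converge; only their weighted primitives do,
  uniformly. After integration by parts \<open>G n - H\<close> is integrated against a kernel that
  is bounded for times in \<open>{T / 2..T}\<close>, and the remaining integral with
  \<open>H\<close> depends continuously on the time.\<close>

lemma localized_initial_limit:
  fixes g G :: "nat \<Rightarrow> real \<Rightarrow> real" and H :: "real \<Rightarrow> real"
  assumes T: "0 < T" and "\<sigma> \<noteq> 0" and "0 < R"
    and s: "\<And>n. 0 < s n" "\<And>n. s n \<le> T / 2" "s \<longlonglongrightarrow> 0"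
    and g: "\<And>n. continuous_on UNIV (g n)"
    and G: "\<And>n y. (G n has_real_derivative g n y * omega \<sigma> y) (at y)"
    and H: "continuous_on UNIV H" and e: "\<And>n y. \<bar>G n y - H y\<bar> \<le> e n" "e \<longlonglongrightarrow> 0"
  defines "a \<equiv> 1 / R ^ 4"
  shows "(\<lambda>n. integral {-R..R} (\<lambda>z. g n (x + z) * (cutoff a z * Theta (T - s n) z)))
      \<longlonglongrightarrow> - integral {-R..R} (\<lambda>z. H (x + z) * localized_kernel' x \<sigma> a T z)"
proof -
  have pos: "0 < T - s n" for n using s(2)[of n] T by linarith
  have cont_k: "continuous_on ({0..T / 2} \<times> {-R..R}) (\<lambda>p. localized_kernel' x \<sigma> a (T - fst p) (snd p))"
    by (rule continuous_on_localized_kernel'_pair) (use T \<open>\<sigma> \<noteq> 0\<close> in \<open>auto intro!: continuous_intros\<close>)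
  have "compact ((\<lambda>p. localized_kernel' x \<sigma> a (T - fst p) (snd p)) ` ({0..T / 2} \<times> {-R..R}))"
    using cont_k by (intro compact_continuous_image compact_Times) auto
  from compact_imp_bounded[OF this] obtain B where
    "\<forall>p\<in>{0..T / 2} \<times> {-R..R}. \<bar>localized_kernel' x \<sigma> a (T - fst p) (snd p)\<bar> \<le> B"
    unfolding bounded_iff by auto
  then have B: "\<bar>localized_kernel' x \<sigma> a (T - s n) z\<bar> \<le> B" if "z \<in> {-R..R}" for n z
    using that s(1,2)[of n] by (auto simp: less_imp_le)
  have contG: "continuous_on UNIV (G n)" for n
    using G by (rule DERIV_imp_continuous_on)
  have int: "(\<lambda>z. F (x + z) * localized_kernel' x \<sigma> a (T - s n) z) integrable_on {-R..R}"
    if "continuous_on UNIV F" for F n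
    by (intro integrable_continuous_interval continuous_on_mult continuous_on_shift that
        continuous_on_localized_kernel' pos \<open>\<sigma> \<noteq> 0\<close>)
  have eq: "integral {-R..R} (\<lambda>z. g n (x + z) * (cutoff a z * Theta (T - s n) z))
      = - integral {-R..R} (\<lambda>z. (G n (x + z) - H (x + z)) * localized_kernel' x \<sigma> a (T - s n) z)
        - integral {-R..R} (\<lambda>z. H (x + z) * localized_kernel' x \<sigma> a (T - s n) z)" for n
  proof -
    have "g n (x + z) * (cutoff a z * Theta (T - s n) z)
        = (g n (x + z) * omega \<sigma> (x + z)) * (cutoff a z * weighted_kernel x \<sigma> (T - s n) z)" for z
      using less_imp_neq[OF omega_pos[of \<sigma> "x + z"]] by (simp add: weighted_kernel_def)
    then have "integral {-R..R} (\<lambda>z. g n (x + z) * (cutoff a z * Theta (T - s n) z))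
        = integral {-R..R} (\<lambda>z. (g n (x + z) * omega \<sigma> (x + z)) * (cutoff a z * weighted_kernel x \<sigma> (T - s n) z))"
      by (rule integral_cong)
    also have "\<dots> = - integral {-R..R} (\<lambda>z. G n (x + z) * localized_kernel' x \<sigma> a (T - s n) z)"
      unfolding a_def
      by (rule localized_by_parts[OF G[of n] continuous_on_mult[OF g[of n] continuous_on_omega] pos[of n]
            \<open>\<sigma> \<noteq> 0\<close> \<open>0 < R\<close>])
    also have "integral {-R..R} (\<lambda>z. G n (x + z) * localized_kernel' x \<sigma> a (T - s n) z)
        = integral {-R..R} (\<lambda>z. (G n (x + z) - H (x + z)) * localized_kernel' x \<sigma> a (T - s n) z)
          + integral {-R..R} (\<lambda>z. H (x + z) * localized_kernel' x \<sigma> a (T - s n) z)"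
      unfolding left_diff_distrib
      using integral_diff[OF int[OF contG, of n n] int[OF H, of n]] by simp
    finally show ?thesis by simp
  qed
  have "(\<lambda>n. integral {-R..R} (\<lambda>z. (G n (x + z) - H (x + z)) * localized_kernel' x \<sigma> a (T - s n) z)) \<longlonglongrightarrow> 0"
  proof (rule tendsto_0_le[OF e(2)])
    have "norm (integral {-R..R} (\<lambda>z. (G n (x + z) - H (x + z)) * localized_kernel' x \<sigma> a (T - s n) z))
        \<le> norm (e n) * (2 * R * B)" for n
    proof -
      have "norm (integral {-R..R} (\<lambda>z. (G n (x + z) - H (x + z)) * localized_kernel' x \<sigma> a (T - s n) z))
          \<le> (e n * B) * (R - - R)"
      proof (rule integral_bound)
        show "continuous_on {-R..R} (\<lambda>z. (G n (x + z) - H (x + z)) * localized_kernel' x \<sigma> a (T - s n) z)"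
          by (intro continuous_on_mult continuous_on_diff continuous_on_shift contG H
              continuous_on_localized_kernel' pos \<open>\<sigma> \<noteq> 0\<close>)
        fix z assume z: "z \<in> {-R..R}"
        have "0 \<le> e n" using e(1)[of n 0] by linarith
        then show "norm ((G n (x + z) - H (x + z)) * localized_kernel' x \<sigma> a (T - s n) z) \<le> e n * B"
          unfolding real_norm_def abs_mult using e(1) B[OF z] by (intro mult_mono) auto
      qed (use \<open>0 < R\<close> in auto)
      also have "\<dots> = norm (e n) * (2 * R * B)"
        using e(1)[of n 0] by (simp add: abs_of_nonneg)
      finally show ?thesis .
    qed
    then show "\<forall>\<^sub>F n in sequentially. norm (integral {-R..R} (\<lambda>z. (G n (x + z) - H (x + z)) * localized_kernel' x \<sigma> a (T - s n) z))
        \<le> norm (e n) * (2 * R * B)"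
      by simp
  qed
  moreover have "(\<lambda>n. integral {-R..R} (\<lambda>z. H (x + z) * localized_kernel' x \<sigma> a (T - s n) z))
      \<longlonglongrightarrow> integral {-R..R} (\<lambda>z. H (x + z) * localized_kernel' x \<sigma> a (T - 0) z)"
  proof -
    have "continuous_on ({0..T / 2} \<times> {-R..R}) (\<lambda>p. H (x + snd p) * localized_kernel' x \<sigma> a (T - fst p) (snd p))"
      by (intro continuous_on_mult cont_k continuous_on_compose2[OF H]) (auto intro!: continuous_intros)
    then have "continuous_on {0..T / 2} (\<lambda>s. integral (cbox (-R) R) (\<lambda>z. H (x + z) * localized_kernel' x \<sigma> a (T - s) z))"
      by (intro integral_continuous_on_param) (simp add: case_prod_unfold)
    from continuous_on_tendsto_compose[OF this s(3)] s(1,2) T show ?thesis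
      by (simp add: less_imp_le)
  qed
  ultimately have "(\<lambda>n. - integral {-R..R} (\<lambda>z. (G n (x + z) - H (x + z)) * localized_kernel' x \<sigma> a (T - s n) z)
      - integral {-R..R} (\<lambda>z. H (x + z) * localized_kernel' x \<sigma> a (T - s n) z))
      \<longlonglongrightarrow> - 0 - integral {-R..R} (\<lambda>z. H (x + z) * localized_kernel' x \<sigma> a (T - 0) z)"
    by (intro tendsto_diff tendsto_minus)
  then show ?thesis
    unfolding eq by simp
qed

section \<open>Removing the cutoff\<close>

lemma gaussian_integrable_on:
  fixes c x :: real
  assumes "0 < c"
  shows "(\<lambda>\<xi>. exp (- c * (\<xi> - x)\<^sup>2)) integrable_on UNIV"
proof -
  define \<sigma> where "\<sigma> = sqrt (1 / (2 * c))"
  have \<sigma>: "0 < \<sigma>" "2 * \<sigma>\<^sup>2 = 1 / c"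
    using assms by (auto simp: \<sigma>_def)
  have "normal_density x \<sigma> integrable_on UNIV"
    using \<sigma> by (intro integrable_on_lborel integrable_normal_density)
  then have "(\<lambda>\<xi>. sqrt (2 * pi * \<sigma>\<^sup>2) * normal_density x \<sigma> \<xi>) integrable_on UNIV"
    by (rule integrable_on_mult_right)
  moreover have "(\<lambda>\<xi>. sqrt (2 * pi * \<sigma>\<^sup>2) * normal_density x \<sigma> \<xi>) = (\<lambda>\<xi>. exp (- c * (\<xi> - x)\<^sup>2))"
    using \<sigma> by (auto simp: normal_density_def)
  ultimately show ?thesis by simp
qed

text \<open>Take \<open>weighted_kernel_bound\<close> at \<open>s = T\<close> with
  \<open>\<delta> = \<tau> - T\<close>. Half of its exponent is spent on the linear growth of the
  logarithmic derivative; the other half is the majorant, uniform in \<open>R \<ge> 1\<close>, under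
  which \<open>R\<close> can tend to infinity.\<close>

lemma localized_kernel'_gaussian_bound:
  fixes x T \<tau> :: real
  assumes T: "0 < T" "T < \<tau>"
  shows "\<exists>c C. 0 < c \<and> 0 < C \<and>
    (\<forall>R z. 1 \<le> R \<longrightarrow> \<bar>z\<bar> \<le> R \<longrightarrow> \<bar>localized_kernel' x \<tau> (1 / R ^ 4) T z\<bar> \<le> C * exp (- c * z\<^sup>2)) \<and>
    (\<forall>z. weighted_kernel x \<tau> T z \<le> C * exp (- c * z\<^sup>2))"
proof -
  obtain c0 C0 where c0: "0 < c0" "0 < C0" and kernel0: "\<And>s \<sigma> z. 0 < s \<Longrightarrow> s \<le> T \<Longrightarrow> s + (\<tau> - T) \<le> \<sigma> \<Longrightarrow>
      weighted_kernel x \<sigma> s z \<le> C0 / sqrt s * exp (- c0 * (z\<^sup>2 / s))"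
    using weighted_kernel_bound[of "\<tau> - T" T x] T by auto
  define c where "c = c0 / (2 * T)"
  define C1 where "C1 = C0 / sqrt T"
  have c: "0 < c" "0 < C1" using c0 T by (auto simp: c_def C1_def)
  have kernel: "weighted_kernel x \<tau> T z \<le> C1 * (exp (- c * z\<^sup>2) * exp (- c * z\<^sup>2))" for z
    using kernel0[of T \<tau> z] T unfolding exp_add[symmetric] by (simp add: c_def C1_def field_simps)
  obtain D where D: "0 < D" "\<And>w. 0 \<le> w \<Longrightarrow> (1 + w) ^ 3 * exp (- c * w) \<le> D"
    using power_exp_bound[OF c(1)] by blast
  \<comment> \<open>16 bounds \<open>cutoff1\<close>, because
    \<open>16 a \<bar>z\<bar>^3 \<le> 16 R^3 / R^4\<close>; the other two summands bound the
    logarithmic derivative of the kernel, with \<tau> replaced by the smaller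
    \<open>T\<close>.\<close>
  define M where "M = 16 + \<bar>x\<bar> / (2 * T) + 1 / T"
  have M: "16 \<le> M" using T by (simp add: M_def)
  have linear: "(1 + \<bar>z\<bar>) * exp (- c * z\<^sup>2) \<le> 2 * D" for z :: real
  proof -
    have "2 * \<bar>z\<bar> \<le> 1 + z\<^sup>2"
      using zero_le_power2[of "\<bar>z\<bar> - 1"] by (simp add: power2_eq_square algebra_simps)
    then have "1 + \<bar>z\<bar> \<le> 2 * (1 + z\<^sup>2) ^ 1"
      using zero_le_power2[of z] unfolding power_one_right distrib_left by argo
    also have "\<dots> \<le> 2 * (1 + z\<^sup>2) ^ 3"
      by (intro mult_left_mono power_increasing) auto
    finally have "(1 + \<bar>z\<bar>) * exp (- c * z\<^sup>2) \<le> 2 * (1 + z\<^sup>2) ^ 3 * exp (- c * z\<^sup>2)"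
      by (rule mult_right_mono) simp
    also have "\<dots> \<le> 2 * D" using D(2)[of "z\<^sup>2"] by simp
    finally show ?thesis .
  qed
  have bound: "(M * (1 + \<bar>z\<bar>)) * weighted_kernel x \<tau> T z \<le> 2 * C1 * M * D * exp (- c * z\<^sup>2)" for z
  proof -
    have "(M * (1 + \<bar>z\<bar>)) * weighted_kernel x \<tau> T z \<le> (M * (1 + \<bar>z\<bar>)) * (C1 * (exp (- c * z\<^sup>2) * exp (- c * z\<^sup>2)))"
      using M by (intro mult_left_mono kernel) auto
    also have "\<dots> = (C1 * M * exp (- c * z\<^sup>2)) * ((1 + \<bar>z\<bar>) * exp (- c * z\<^sup>2))"
      by (simp add: mult_ac)
    also have "\<dots> \<le> (C1 * M * exp (- c * z\<^sup>2)) * (2 * D)"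
      using M c by (intro mult_left_mono linear) auto
    finally show ?thesis by (simp add: mult_ac)
  qed
  show ?thesis
  proof (rule exI[of _ c], rule exI[of _ "2 * C1 * M * D"], intro conjI allI impI)
    show "0 < c" "0 < 2 * C1 * M * D" using c D M by auto
    show "weighted_kernel x \<tau> T z \<le> 2 * C1 * M * D * exp (- c * z\<^sup>2)" for z
    proof -
      have "1 * 1 \<le> M * (1 + \<bar>z\<bar>)" using M by (intro mult_mono) auto
      then have "1 * weighted_kernel x \<tau> T z \<le> (M * (1 + \<bar>z\<bar>)) * weighted_kernel x \<tau> T z"
        using weighted_kernel_pos[OF T(1), of x \<tau> z] by (intro mult_right_mono) auto
      with bound[of z] show ?thesis by simp
    qed
    fix R z :: real assume R: "1 \<le> R" "\<bar>z\<bar> \<le> R"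
    have "z ^ 4 \<le> R ^ 4"
      using power_mono[OF R(2), of 4] by (simp add: power_even_abs)
    then have a: "0 \<le> 1 / R ^ 4" "1 / R ^ 4 * z ^ 4 \<le> 1" using R by (auto simp: field_simps)
    note cut = cutoff_bounds[OF a]
    have "\<bar>z\<bar> ^ 3 \<le> R ^ 3" using R by (intro power_mono) auto
    also have "\<dots> \<le> R ^ 4" using R by (intro power_increasing) auto
    finally have "16 * (1 / R ^ 4) * \<bar>z\<bar> ^ 3 \<le> 16" using R by (simp add: field_simps)
    then have cut1: "\<bar>cutoff1 (1 / R ^ 4) z\<bar> \<le> 16" using cut(3) by linarith
    have "\<bar>(x + z) / (2 * \<tau>) - z / (2 * T)\<bar> \<le> \<bar>x + z\<bar> / (2 * \<tau>) + \<bar>z\<bar> / (2 * T)"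
      using abs_triangle_ineq4[of "(x + z) / (2 * \<tau>)" "z / (2 * T)"] T by simp
    also have "\<bar>x + z\<bar> / (2 * \<tau>) \<le> (\<bar>x\<bar> + \<bar>z\<bar>) / (2 * T)"
      using T by (intro frac_le) auto
    finally have "\<bar>(x + z) / (2 * \<tau>) - z / (2 * T)\<bar> \<le> \<bar>x\<bar> / (2 * T) + 1 / T * \<bar>z\<bar>"
      using T by (simp add: field_simps)
    then have "16 + \<bar>(x + z) / (2 * \<tau>) - z / (2 * T)\<bar> \<le> M * (1 + \<bar>z\<bar>)"
    proof -
      have "16 + (p + q * y) \<le> (16 + p + q) * (1 + y)" if "0 \<le> (16 + p) * y" "0 \<le> q" for p q y :: real
        using that by (simp add: algebra_simps)
      from this[of "\<bar>x\<bar> / (2 * T)" "\<bar>z\<bar>" "1 / T"] T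
      have "16 + (\<bar>x\<bar> / (2 * T) + 1 / T * \<bar>z\<bar>) \<le> M * (1 + \<bar>z\<bar>)"
        unfolding M_def by auto
      with \<open>\<bar>(x + z) / (2 * \<tau>) - z / (2 * T)\<bar> \<le> \<bar>x\<bar> / (2 * T) + 1 / T * \<bar>z\<bar>\<close> show ?thesis by linarith
    qed
    moreover have "\<bar>localized_kernel' x \<tau> (1 / R ^ 4) T z\<bar>
        \<le> 16 * weighted_kernel x \<tau> T z + 1 * (weighted_kernel x \<tau> T z * \<bar>(x + z) / (2 * \<tau>) - z / (2 * T)\<bar>)"
      unfolding localized_kernel'_def
    proof (rule order_trans[OF abs_triangle_ineq add_mono])
      have w: "0 \<le> weighted_kernel x \<tau> T z" using weighted_kernel_pos[OF T(1), of x \<tau> z] by simp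
      show "\<bar>cutoff1 (1 / R ^ 4) z * weighted_kernel x \<tau> T z\<bar> \<le> 16 * weighted_kernel x \<tau> T z"
        unfolding abs_mult using cut1 w by (intro mult_mono) auto
      show "\<bar>cutoff (1 / R ^ 4) z * (weighted_kernel x \<tau> T z * ((x + z) / (2 * \<tau>) - z / (2 * T)))\<bar>
          \<le> 1 * (weighted_kernel x \<tau> T z * \<bar>(x + z) / (2 * \<tau>) - z / (2 * T)\<bar>)"
        unfolding abs_mult using cut(1,2) w by (intro mult_mono) auto
    qed
    moreover have "\<dots> = (16 + \<bar>(x + z) / (2 * \<tau>) - z / (2 * T)\<bar>) * weighted_kernel x \<tau> T z"
      by (simp add: algebra_simps)
    moreover have "\<dots> \<le> (M * (1 + \<bar>z\<bar>)) * weighted_kernel x \<tau> T z"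
      using calculation(1) weighted_kernel_pos[OF T(1), of x \<tau> z] by (intro mult_right_mono) auto
    ultimately show "\<bar>localized_kernel' x \<tau> (1 / R ^ 4) T z\<bar> \<le> 2 * C1 * M * D * exp (- c * z\<^sup>2)"
      using bound[of z] by linarith
  qed
qed

text \<open>The boundary term of \<open>ac_int\<close> vanishes: \<open>F\<close> is bounded and, as
  \<open>T < \<tau>\<close>, the multiplier decays like a Gaussian. Only the Stieltjes term
  remains.\<close>

lemma heat_conv_eq:
  assumes T: "0 < T" "T < \<tau>" and f: "acprim \<tau> f F"
  shows "heat_conv \<tau> f T x = - integral UNIV
      (\<lambda>\<xi>. F \<xi> * (weighted_kernel x \<tau> T (\<xi> - x) * (\<xi> / (2 * \<tau>) - (\<xi> - x) / (2 * T))))"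
proof -
  have F: "F \<in> Bc" using f by (simp add: acprim_def)
  let ?h = "\<lambda>\<xi>. Theta T (x - \<xi>) / omega \<tau> \<xi>"
  have h: "?h = (\<lambda>\<xi>. weighted_kernel x \<tau> T (\<xi> - x))"
    by (simp add: weighted_kernel_def Theta_def power2_commute)
  have deriv_h: "deriv ?h = (\<lambda>\<xi>. weighted_kernel x \<tau> T (\<xi> - x) * (\<xi> / (2 * \<tau>) - (\<xi> - x) / (2 * T)))"
  proof (rule ext, rule DERIV_imp_deriv)
    fix \<xi>
    have "((\<lambda>\<xi>. weighted_kernel x \<tau> T (- x + \<xi>)) has_real_derivative
        weighted_kernel x \<tau> T (- x + \<xi>) * ((x + (- x + \<xi>)) / (2 * \<tau>) - (- x + \<xi>) / (2 * T))) (at \<xi>)"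
      by (rule DERIV_shift[where f' = "\<lambda>z. weighted_kernel x \<tau> T z * ((x + z) / (2 * \<tau>) - z / (2 * T))"],
          rule DERIV_weighted_kernel) (use T in auto)
    then show "(?h has_real_derivative weighted_kernel x \<tau> T (\<xi> - x) * (\<xi> / (2 * \<tau>) - (\<xi> - x) / (2 * T))) (at \<xi>)"
      unfolding h by simp
  qed
  obtain B where B: "\<And>x. \<bar>F x\<bar> \<le> B"
    using Bc_bounded[OF F] by blast
  obtain c C where c: "0 < c" "0 < C" and kernel: "\<And>z. weighted_kernel x \<tau> T z \<le> C * exp (- c * z\<^sup>2)"
    using localized_kernel'_gaussian_bound[OF T, of x] by blast
  have "((\<lambda>\<xi>. F \<xi> * ?h \<xi>) \<longlongrightarrow> 0) at_top"
  proof (rule tendsto_0_le)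
    show "((\<lambda>\<xi>. B * (C * exp (- c * (\<xi> - x)\<^sup>2))) \<longlongrightarrow> 0) at_top"
      using c(1) by real_asymp
    have "norm (F \<xi> * ?h \<xi>) \<le> norm (B * (C * exp (- c * (\<xi> - x)\<^sup>2))) * 1" for \<xi>
    proof -
      have "\<bar>F \<xi>\<bar> * \<bar>weighted_kernel x \<tau> T (\<xi> - x)\<bar> \<le> B * (C * exp (- c * (\<xi> - x)\<^sup>2))"
        using B[of \<xi>] kernel[of "\<xi> - x"] weighted_kernel_pos[OF T(1), of x \<tau> "\<xi> - x"] by (intro mult_mono) auto
      then show ?thesis
        unfolding fun_cong[OF h] real_norm_def abs_mult[of "F \<xi>"] by linarith
    qed
    then show "\<forall>\<^sub>F \<xi> in at_top. norm (F \<xi> * ?h \<xi>) \<le> norm (B * (C * exp (- c * (\<xi> - x)\<^sup>2))) * 1"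
      by simp
  qed
  then have "Lim at_top (\<lambda>\<xi>. F \<xi> * ?h \<xi>) = 0"
    by (intro tendsto_Lim) auto
  then show ?thesis
    unfolding heat_conv_def The_acprim[OF f] ac_int_def deriv_h by simp
qed

text \<open>As the radius grows, \<open>a = 1 / R^4\<close> tends to 0, so pointwise
  \<open>cutoff\<close> tends to 1 and \<open>cutoff1\<close> to 0, which leaves the derivative of
  the full multiplier; the Gaussian bound dominates.\<close>

lemma localized_kernel'_limit:
  assumes T: "0 < T" "T < \<tau>" and F: "F \<in> Bc"
  shows "(\<lambda>n. integral {- real (Suc n)..real (Suc n)} (\<lambda>z. F (x + z) * localized_kernel' x \<tau> (1 / real (Suc n) ^ 4) T z))
    \<longlonglongrightarrow> integral UNIV (\<lambda>\<xi>. F \<xi> * (weighted_kernel x \<tau> T (\<xi> - x) * (\<xi> / (2 * \<tau>) - (\<xi> - x) / (2 * T))))"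
proof -
  obtain B where B: "0 < B" "\<And>x. \<bar>F x\<bar> \<le> B"
    using Bc_bounded[OF F] by blast
  obtain c C where c: "0 < c" "0 < C"
    and bound: "\<And>R z. 1 \<le> R \<Longrightarrow> \<bar>z\<bar> \<le> R \<Longrightarrow> \<bar>localized_kernel' x \<tau> (1 / R ^ 4) T z\<bar> \<le> C * exp (- c * z\<^sup>2)"
    using localized_kernel'_gaussian_bound[OF T, of x] by blast
  define R where "R n = real (Suc n)" for n
  define k where "k n \<xi> = F \<xi> * localized_kernel' x \<tau> (1 / R n ^ 4) T (\<xi> - x)" for n \<xi>
  let ?S = "\<lambda>n. {- R n + x..R n + x}"
  have int: "((\<lambda>\<xi>. if \<xi> \<in> ?S n then k n \<xi> else 0) has_integral
      integral {-R n..R n} (\<lambda>z. F (x + z) * localized_kernel' x \<tau> (1 / R n ^ 4) T z)) UNIV" for n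
  proof -
    have "(\<lambda>z. F (x + z) * localized_kernel' x \<tau> (1 / R n ^ 4) T z) integrable_on {-R n..R n}"
      using T by (intro integrable_continuous_interval continuous_on_mult continuous_on_shift BcD[OF F]
          continuous_on_localized_kernel') auto
    then have "((\<lambda>z. F (x + z) * localized_kernel' x \<tau> (1 / R n ^ 4) T z) has_integral
        integral {-R n..R n} (\<lambda>z. F (x + z) * localized_kernel' x \<tau> (1 / R n ^ 4) T z)) {-R n..R n}"
      by (rule integrable_integral)
    moreover have "(\<lambda>z. F (x + z) * localized_kernel' x \<tau> (1 / R n ^ 4) T z) = k n \<circ> (+) x"
      by (auto simp: k_def)
    ultimately show ?thesis
      unfolding has_integral_restrict_UNIV using has_integral_shift_Icc_real[of "k n" x] by metis
  qed
  have "(\<lambda>n. integral UNIV (\<lambda>\<xi>. if \<xi> \<in> ?S n then k n \<xi> else 0)) \<longlonglongrightarrow>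
      integral UNIV (\<lambda>\<xi>. F \<xi> * (weighted_kernel x \<tau> T (\<xi> - x) * (\<xi> / (2 * \<tau>) - (\<xi> - x) / (2 * T))))"
  proof (rule dominated_convergence(2))
    show "(\<lambda>\<xi>. if \<xi> \<in> ?S n then k n \<xi> else 0) integrable_on UNIV" for n
      using int by blast
    show "(\<lambda>\<xi>. (B * C) * exp (- c * (\<xi> - x)\<^sup>2)) integrable_on UNIV"
      by (intro integrable_on_mult_right gaussian_integrable_on c(1))
    show "norm (if \<xi> \<in> ?S n then k n \<xi> else 0) \<le> (B * C) * exp (- c * (\<xi> - x)\<^sup>2)" for n \<xi>
    proof (cases "\<xi> \<in> ?S n")
      case True
      then have "\<bar>localized_kernel' x \<tau> (1 / R n ^ 4) T (\<xi> - x)\<bar> \<le> C * exp (- c * (\<xi> - x)\<^sup>2)"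
        by (intro bound) (auto simp: R_def)
      then have "\<bar>F \<xi>\<bar> * \<bar>localized_kernel' x \<tau> (1 / R n ^ 4) T (\<xi> - x)\<bar> \<le> B * (C * exp (- c * (\<xi> - x)\<^sup>2))"
        using B by (intro mult_mono) (auto simp: less_imp_le)
      with True show ?thesis by (simp add: k_def abs_mult)
    qed (use B(1) c(2) in auto)
    fix \<xi>
    have "filterlim R at_top sequentially"
      unfolding R_def by (rule filterlim_compose[OF filterlim_real_sequentially filterlim_Suc])
    then have "\<forall>\<^sub>F n in sequentially. \<bar>\<xi> - x\<bar> \<le> R n"
      by (simp add: filterlim_at_top)
    then have ev: "\<forall>\<^sub>F n in sequentially. \<xi> \<in> ?S n"
      by (rule eventually_mono) auto
    have a: "(\<lambda>n. 1 / R n ^ 4) \<longlonglongrightarrow> 0"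
      unfolding R_def by real_asymp
    have "(\<lambda>n. k n \<xi>) \<longlonglongrightarrow> F \<xi> * ((- 16 * 0 * (\<xi> - x) ^ 3 * (1 - 0 * (\<xi> - x) ^ 4) ^ 3) * weighted_kernel x \<tau> T (\<xi> - x)
        + (1 - 0 * (\<xi> - x) ^ 4) ^ 4 * (weighted_kernel x \<tau> T (\<xi> - x) * ((x + (\<xi> - x)) / (2 * \<tau>) - (\<xi> - x) / (2 * T))))"
      unfolding k_def localized_kernel'_def cutoff_def cutoff1_def by (intro tendsto_intros a)
    then have "(\<lambda>n. k n \<xi>) \<longlonglongrightarrow> F \<xi> * (weighted_kernel x \<tau> T (\<xi> - x) * (\<xi> / (2 * \<tau>) - (\<xi> - x) / (2 * T)))"
      by simp
    then show "(\<lambda>n. if \<xi> \<in> ?S n then k n \<xi> else 0)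
        \<longlonglongrightarrow> F \<xi> * (weighted_kernel x \<tau> T (\<xi> - x) * (\<xi> / (2 * \<tau>) - (\<xi> - x) / (2 * T)))"
      by (rule Lim_transform_eventually) (use ev in \<open>auto elim!: eventually_mono\<close>)
  qed
  then show ?thesis
    unfolding integral_unique[OF int] unfolding R_def .
qed

section \<open>Uniqueness\<close>

text \<open>The hypotheses give a bound for each weight \<open>\<sigma>\<close> separately; here finitely many weights
  \<open>k \<delta>\<close> suffice for all times in \<open>{0<..<T}\<close>.\<close>
lemma uniform_primitive_bound:
  fixes u :: "real \<Rightarrow> real \<Rightarrow> real"
  assumes T: "0 < T" "T < \<tau>"
    and cont: "\<And>t. 0 < t \<Longrightarrow> t < \<tau> \<Longrightarrow> continuous_on UNIV (\<lambda>x. u x t)"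
    and mem: "\<And>\<sigma> t. 0 < \<sigma> \<Longrightarrow> \<sigma> < \<tau> \<Longrightarrow> 0 < t \<Longrightarrow> t < \<tau> - \<sigma> \<Longrightarrow> Acw \<sigma> (fun_dist (\<lambda>x. u x t))"
    and bnd: "\<And>\<sigma>. 0 < \<sigma> \<Longrightarrow> \<sigma> < \<tau> \<Longrightarrow> \<exists>M. \<forall>t. 0 < t \<and> t < \<tau> - \<sigma> \<longrightarrow>
               \<bar>wnorm \<sigma> (fun_dist (\<lambda>x. u x t)) * sqrt (\<tau> - \<sigma> - t)\<bar> \<le> M"
  defines "\<delta> \<equiv> (\<tau> - T) / 3"
  shows "\<exists>N. \<forall>t. 0 < t \<longrightarrow> t < T \<longrightarrow> (\<exists>\<sigma> G. T - t + \<delta> \<le> \<sigma> \<and>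
        (\<forall>y. (G has_real_derivative u y t * omega \<sigma> y) (at y)) \<and> (\<forall>y. \<bar>G y\<bar> \<le> N))"
proof -
  have \<delta>: "0 < \<delta>" using T by (simp add: \<delta>_def)
  obtain M where M: "\<And>\<sigma> t. 0 < \<sigma> \<Longrightarrow> \<sigma> < \<tau> \<Longrightarrow> 0 < t \<Longrightarrow> t < \<tau> - \<sigma> \<Longrightarrow>
      \<bar>wnorm \<sigma> (fun_dist (\<lambda>x. u x t)) * sqrt (\<tau> - \<sigma> - t)\<bar> \<le> M \<sigma>"
    using bnd by metis
  \<comment> \<open>An upper bound, valid for all \<open>t\<close>, for the index \<open>k\<close>
    chosen below; the sum \<open>N\<close> then dominates the bound of every weight that
    occurs.\<close>
  define m where "m = nat \<lceil>(T + 2 * \<delta>) / \<delta>\<rceil>"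
  define N where "N = (\<Sum>k\<le>m. \<bar>M (real k * \<delta>)\<bar> / sqrt \<delta>)"
  show ?thesis
  proof (rule exI[of _ N], intro allI impI)
    fix t assume t: "0 < t" "t < T"
    \<comment> \<open>Rounding up to a multiple of \<delta> and adding one more puts \<sigma>
      between \<open>T - t + \<delta>\<close> and \<open>T - t + 2 * \<delta>\<close>. As
      \<open>\<tau> = T + 3 * \<delta>\<close>, a third \<delta> remains for
      \<open>\<tau> - \<sigma> - t\<close>, which bounds the square root from below.\<close>
    define k where "k = nat (\<lceil>(T - t) / \<delta>\<rceil> + 1)"
    define \<sigma> where "\<sigma> = real k * \<delta>"
    have pos: "0 \<le> (T - t) / \<delta>" using t \<delta> by simp
    have k: "(T - t) / \<delta> + 1 \<le> real k" "real k \<le> (T - t) / \<delta> + 2"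
      using pos unfolding k_def by linarith+
    have \<sigma>: "T - t + \<delta> \<le> \<sigma>" "\<sigma> \<le> T - t + 2 * \<delta>"
      using mult_right_mono[OF k(1), of \<delta>] mult_right_mono[OF k(2), of \<delta>] \<delta>
      by (simp_all add: \<sigma>_def distrib_right)
    have \<tau>: "\<tau> = T + 3 * \<delta>" unfolding \<delta>_def by argo
    have \<sigma>': "0 < \<sigma>" "\<sigma> < \<tau>" "t < \<tau> - \<sigma>" "\<delta> \<le> \<tau> - \<sigma> - t"
      using \<sigma> t \<delta> \<tau> by linarith+
    have "real k \<le> (T + 2 * \<delta>) / \<delta>"
      using k(2) t \<delta> by (simp add: field_simps)
    then have "k \<le> m" unfolding m_def by linarith
    obtain G where G: "acprim \<sigma> (fun_dist (\<lambda>x. u x t)) G"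
      using mem[OF \<sigma>'(1,2) t(1) \<sigma>'(3)] by (auto simp: Acw_def)
    then have Bc: "G \<in> Bc" by (simp add: acprim_def)
    have "alex_norm G * sqrt \<delta> \<le> alex_norm G * sqrt (\<tau> - \<sigma> - t)"
      using \<sigma>' alex_norm_nonneg[OF Bc] by (intro mult_left_mono) auto
    also have "\<dots> \<le> \<bar>M \<sigma>\<bar>"
      using M[OF \<sigma>'(1,2) t(1) \<sigma>'(3)] wnorm_eq[OF G] by simp
    finally have "alex_norm G \<le> \<bar>M \<sigma>\<bar> / sqrt \<delta>"
      using \<delta> by (simp add: field_simps)
    also have "\<dots> \<le> N"
      unfolding N_def \<sigma>_def using \<open>k \<le> m\<close> \<delta>
      by (intro member_le_sum[where f = "\<lambda>k. \<bar>M (real k * \<delta>)\<bar> / sqrt \<delta>"]) auto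
    finally have "\<bar>G y\<bar> \<le> N" for y
      using abs_le_alex_norm[OF Bc, of y] by linarith
    moreover have "(G has_real_derivative u y t * omega \<sigma> y) (at y)" for y
      using t T by (intro acprim_fun_dist_DERIV[OF G] cont) auto
    ultimately show "\<exists>\<sigma> G. T - t + \<delta> \<le> \<sigma> \<and>
        (\<forall>y. (G has_real_derivative u y t * omega \<sigma> y) (at y)) \<and> (\<forall>y. \<bar>G y\<bar> \<le> N)"
      using \<sigma>(1) by blast
  qed
qed

theorem theorem6p6:
  fixes \<tau> :: real and u ux uxx ut :: "real \<Rightarrow> real \<Rightarrow> real" and f :: distr
  assumes tau_pos: "0 < \<tau>"
    and ux: "\<And>x t. 0 < t \<Longrightarrow> t < \<tau> \<Longrightarrow> ((\<lambda>y. u y t) has_real_derivative ux x t) (at x)"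
    and uxx: "\<And>x t. 0 < t \<Longrightarrow> t < \<tau> \<Longrightarrow> ((\<lambda>y. ux y t) has_real_derivative uxx x t) (at x)"
    and ut: "\<And>x t. 0 < t \<Longrightarrow> t < \<tau> \<Longrightarrow> ((\<lambda>s. u x s) has_real_derivative ut x t) (at t)"
    and cont: "continuous_on (UNIV \<times> {0<..<\<tau>}) (\<lambda>p. u (fst p) (snd p))"
              "continuous_on (UNIV \<times> {0<..<\<tau>}) (\<lambda>p. ux (fst p) (snd p))"
              "continuous_on (UNIV \<times> {0<..<\<tau>}) (\<lambda>p. uxx (fst p) (snd p))"
              "continuous_on (UNIV \<times> {0<..<\<tau>}) (\<lambda>p. ut (fst p) (snd p))"
    and heat: "\<And>x t. 0 < t \<Longrightarrow> t < \<tau> \<Longrightarrow> ut x t - uxx x t = 0"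
    and f_mem: "Acw \<tau> f"
    and mem: "\<And>\<sigma> t. 0 < \<sigma> \<Longrightarrow> \<sigma> < \<tau> \<Longrightarrow> 0 < t \<Longrightarrow> t < \<tau> - \<sigma> \<Longrightarrow>
               Acw \<sigma> (fun_dist (\<lambda>x. u x t))"
    and bnd: "\<And>\<sigma>. 0 < \<sigma> \<Longrightarrow> \<sigma> < \<tau> \<Longrightarrow> \<exists>M. \<forall>t. 0 < t \<and> t < \<tau> - \<sigma> \<longrightarrow>
               \<bar>wnorm \<sigma> (fun_dist (\<lambda>x. u x t)) * sqrt (\<tau> - \<sigma> - t)\<bar> \<le> M"
    and lim: "\<And>\<sigma>. 0 < \<sigma> \<Longrightarrow> \<sigma> < \<tau> \<Longrightarrow>
               ((\<lambda>t. wnorm \<sigma> (\<lambda>\<phi>. fun_dist (\<lambda>x. u x t) \<phi> - f \<phi>)) \<longlongrightarrow> 0) (at_right 0)"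
  shows "\<forall>x t. 0 < t \<and> t < \<tau> \<longrightarrow> u x t = heat_conv \<tau> f t x"
proof (intro allI impI, elim conjE)
  fix x T assume T: "0 < T" "T < \<tau>"
  have cont_slice: "continuous_on UNIV (\<lambda>x. u x t)" if "0 < t" "t < \<tau>" for t
    using ux[OF that] by (rule DERIV_imp_continuous_on)
  obtain F where F: "acprim \<tau> f F"
    using f_mem by (auto simp: Acw_def)
  then have F_Bc: "F \<in> Bc" by (simp add: acprim_def)
  define \<delta> where "\<delta> = (\<tau> - T) / 3"
  have \<delta>: "0 < \<delta>" using T by (simp add: \<delta>_def)
  obtain N where N: "\<And>t. 0 < t \<Longrightarrow> t < T \<Longrightarrow> \<exists>\<sigma> G. T - t + \<delta> \<le> \<sigma> \<and>
        (\<forall>y. (G has_real_derivative u y t * omega \<sigma> y) (at y)) \<and> (\<forall>y. \<bar>G y\<bar> \<le> N)"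
    using uniform_primitive_bound[OF T cont_slice mem bnd] unfolding \<delta>_def by blast
  obtain K where K: "\<And>s \<sigma> z R. \<lbrakk>0 < s; s \<le> T; s + \<delta> \<le> \<sigma>; 1 \<le> R; \<bar>z\<bar> \<le> R\<rbrakk> \<Longrightarrow>
      \<bar>weighted_kernel x \<sigma> s z * error_flux' x \<sigma> (1 / R ^ 4) s z\<bar> \<le> K / R\<^sup>2"
    using error_kernel_bound[OF \<delta> T(1), of x] by blast
  define \<sigma> where "\<sigma> = (T + \<tau>) / 2"
  have \<sigma>: "0 < \<sigma>" "\<sigma> < \<tau>" using T by (auto simp: \<sigma>_def)
  define c where "c = 1 / (4 * \<sigma>) - 1 / (4 * \<tau>)"
  obtain Q where Q: "\<And>y. (Q has_real_derivative F y * (- 2 * c * y * exp (- c * y\<^sup>2))) (at y)"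
    and H: "acprim \<sigma> f (\<lambda>y. F y * exp (- c * y\<^sup>2) - Q y)"
    using acprim_change_weight[OF F \<sigma>] unfolding c_def by blast
  define H where "H y = F y * exp (- c * y\<^sup>2) - Q y" for y
  have H: "acprim \<sigma> f H" using H by (simp add: H_def[abs_def])
  then have H_Bc: "H \<in> Bc" by (simp add: acprim_def)
  \<comment> \<open>One sequence serves both ends: \<open>s n \<le> T / 2\<close> keeps
    \<open>T - s n\<close> away from 0, and \<open>s n < \<tau> - \<sigma>\<close> puts
    \<open>u\<close> at time \<open>s n\<close> into the space with weight \<sigma>.\<close>
  define S where "S = min (T / 2) ((\<tau> - \<sigma>) / 2)"
  define s where "s n = S / real (Suc n)" for n
  have S: "0 < S" using T \<sigma> by (simp add: S_def)
  have "S \<le> T / 2" "S < \<tau> - \<sigma>" using \<sigma> by (auto simp: S_def min_def)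
  moreover have "0 < s n" "s n \<le> S" for n
    using S by (simp_all add: s_def field_simps)
  ultimately have s: "0 < s n" "s n \<le> T / 2" "s n < \<tau> - \<sigma>" for n
    by (blast intro: order_trans le_less_trans)+
  have s_lim: "s \<longlonglongrightarrow> 0"
    unfolding s_def by (rule LIMSEQ_Suc[OF lim_const_over_n])
  have s\<tau>: "s n < \<tau>" for n using s(3)[of n] \<sigma> by linarith
  have "\<exists>G. acprim \<sigma> (fun_dist (\<lambda>x. u x (s n))) G" for n
    using mem[OF \<sigma> s(1) s(3)] by (simp add: Acw_def)
  then obtain G where G: "\<And>n. acprim \<sigma> (fun_dist (\<lambda>x. u x (s n))) (G n)"
    by metis
  define e where "e n = wnorm \<sigma> (\<lambda>\<phi>. fun_dist (\<lambda>x. u x (s n)) \<phi> - f \<phi>)" for n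
  \<comment> \<open>The difference of the primitives is the primitive of the difference, so the norm
    bounds their uniform distance.\<close>
  have e: "\<bar>G n y - H y\<bar> \<le> e n" for n y
    unfolding e_def wnorm_eq[OF acprim_diff[OF G H]]
    by (rule abs_le_alex_norm[OF Bc_diff[OF _ H_Bc], where x = y]) (use G[of n] in \<open>simp add: acprim_def\<close>)
  have e_lim: "e \<longlonglongrightarrow> 0"
    unfolding e_def using s(1) s_lim less_imp_neq[OF s(1)]
    by (intro filterlim_compose[OF lim[OF \<sigma>]]) (auto simp: filterlim_at intro!: always_eventually)
  define J where "J R = integral {-R..R} (\<lambda>z. F (x + z) * localized_kernel' x \<tau> (1 / R ^ 4) T z)" for R
  \<comment> \<open>\<open>u x T\<close> and \<open>- J R\<close> are the limits of the pairing at
    the two ends of the time interval, so the bound on its increments passes to their difference.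
    \<open>N\<close> and \<open>K\<close> were fixed before \<open>R\<close>, which leaves
    \<open>R\<close> free to tend to infinity.\<close>
  have key: "\<bar>u x T + J R\<bar> \<le> 2 * N * K * T / R" if R: "1 \<le> R" for R
  proof -
    define v where "v t = integral {-R..R} (\<lambda>z. u (x + z) t * (cutoff (1 / R ^ 4) z * Theta (T - t) z))" for t
    have "\<bar>v (T - s n) - v (s n)\<bar> \<le> 2 * N * K * T / R" for n
      unfolding v_def
    proof (rule localized_increment_bound[OF T \<delta> ux uxx ut cont(1,4) _ N])
      show "ut x t = uxx x t" if "0 < t" "t < \<tau>" for x t
        using heat[OF that, of x] by simp
    qed (use K R s[of n] T in auto)
    moreover have "(\<lambda>n. v (T - s n)) \<longlonglongrightarrow> u x T"
      using localized_terminal_limit[OF T cont(1), of R s x "1 / R ^ 4"] R s s_lim by (simp add: v_def)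
    moreover have "(\<lambda>n. v (s n)) \<longlonglongrightarrow> - J R"
    proof -
      have "J R = integral {-R..R} (\<lambda>z. H (x + z) * localized_kernel' x \<sigma> (1 / R ^ 4) T z)"
        unfolding J_def H_def c_def
        by (rule localized_change_weight[symmetric, OF BcD(1)[OF F_Bc] \<sigma> T(1)])
          (use R Q in \<open>auto simp: c_def\<close>)
      moreover have "(\<lambda>n. v (s n)) \<longlonglongrightarrow> - integral {-R..R} (\<lambda>z. H (x + z) * localized_kernel' x \<sigma> (1 / R ^ 4) T z)"
        unfolding v_def
      proof (rule localized_initial_limit[OF T(1) _ _ s(1,2) s_lim _ _ BcD(1)[OF H_Bc] e e_lim])
        show "continuous_on UNIV (\<lambda>y. u y (s n))" for n
          using s(1) s\<tau> by (rule cont_slice)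
        then show "(G n has_real_derivative u y (s n) * omega \<sigma> y) (at y)" for n y
          by (rule acprim_fun_dist_DERIV[OF G])
      qed (use R \<sigma> in auto)
      ultimately show ?thesis by simp
    qed
    ultimately have "(\<lambda>n. \<bar>v (T - s n) - v (s n)\<bar>) \<longlonglongrightarrow> \<bar>u x T - - J R\<bar>"
      by (intro tendsto_rabs tendsto_diff)
    then have "\<bar>u x T - - J R\<bar> \<le> 2 * N * K * T / R"
      by (rule LIMSEQ_le_const2)
        (use \<open>\<And>n. \<bar>v (T - s n) - v (s n)\<bar> \<le> 2 * N * K * T / R\<close> in blast)
    then show ?thesis by simp
  qed
  have "(\<lambda>n. u x T + J (real (Suc n))) \<longlonglongrightarrow> 0"
  proof (rule tendsto_0_le)
    show "(\<lambda>n. 2 * N * K * T / real (Suc n)) \<longlonglongrightarrow> 0"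
      by (rule LIMSEQ_Suc[OF lim_const_over_n])
    have "norm (u x T + J (real (Suc n))) \<le> norm (2 * N * K * T / real (Suc n)) * 1" for n
      using order_trans[OF key[of "real (Suc n)"] abs_ge_self] by simp
    then show "\<forall>\<^sub>F n in sequentially. norm (u x T + J (real (Suc n))) \<le> norm (2 * N * K * T / real (Suc n)) * 1"
      by simp
  qed
  moreover have "(\<lambda>n. u x T + J (real (Suc n))) \<longlonglongrightarrow> u x T + - heat_conv \<tau> f T x"
    unfolding heat_conv_eq[OF T F] J_def minus_minus
    by (intro tendsto_add tendsto_const localized_kernel'_limit[OF T F_Bc])
  ultimately have "u x T + - heat_conv \<tau> f T x = 0"
    by (rule LIMSEQ_unique[rotated])
  then show "u x T = heat_conv \<tau> f T x" by simp
qed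

end
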